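(* There is an absolute constant $C>0$ such that for every integer $r\geq 2$ and every sufficiently large even integer $n$ (i.e. $n\geq n_0(r)$), there exists a bipartite graph $G$ with at most $C\,r^{120}(\ln^2 r)\,n$ edges such that $G\longrightarrow_{1/r}C_n$.
   Context: For graphs $G,H$ and a real $0<\gamma<1$, we write $G\longrightarrow_{\gamma}H$ if every subgraph $J$ of $G$ with $e(J)\geq\gamma\, e(G)$ contains a copy of $H$ as a subgraph; here $e(\cdot)$ is the number of edges. $C_n$ denotes the cycle on $n$ vertices. *)

theory Defs
  imports Complex_Main
begin

record 'a ugraph =
  verts :: "'a set"
  edges :: "'a set set"

definition fin_graph :: "'a ugraph \<Rightarrow> bool" where
  "fin_graph G \<longleftrightarrow> finite (verts G) \<and> (\<forall>e\<in>edges G. e \<subseteq> verts G \<and> card e = 2)"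

definition num_edges :: "'a ugraph \<Rightarrow> nat" where
  "num_edges G = card (edges G)"

definition bipartite :: "'a ugraph \<Rightarrow> bool" where
  "bipartite G \<longleftrightarrow> (\<exists>A B. A \<union> B = verts G \<and> A \<inter> B = {} \<and>
     (\<forall>e\<in>edges G. \<exists>a\<in>A. \<exists>b\<in>B. e = {a, b}))"

definition subgraph :: "'a ugraph \<Rightarrow> 'a ugraph \<Rightarrow> bool" where
  "subgraph J G \<longleftrightarrow> fin_graph J \<and> verts J \<subseteq> verts G \<and> edges J \<subseteq> edges G"

definition isomorphic :: "'a ugraph \<Rightarrow> 'b ugraph \<Rightarrow> bool" where
  "isomorphic G H \<longleftrightarrow> (\<exists>f. bij_betw f (verts G) (verts H) \<and>
     (\<forall>u\<in>verts G. \<forall>v\<in>verts G. {u, v} \<in> edges G \<longleftrightarrow> {f u, f v} \<in> edges H))"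

definition contains_copy :: "'a ugraph \<Rightarrow> 'b ugraph \<Rightarrow> bool" where
  "contains_copy G H \<longleftrightarrow> (\<exists>K. subgraph K G \<and> isomorphic K H)"

definition arrows :: "'a ugraph \<Rightarrow> real \<Rightarrow> 'b ugraph \<Rightarrow> bool" where
  "arrows G \<gamma> H \<longleftrightarrow>
     (\<forall>J. subgraph J G \<and> real (num_edges J) \<ge> \<gamma> * real (num_edges G) \<longrightarrow> contains_copy J H)"

(* The cycle on n vertices for n \<ge> 3; degenerate for smaller n. *)
definition cycle_graph :: "nat \<Rightarrow> nat ugraph" where
  "cycle_graph n = \<lparr>verts = {..<n}, edges = {{i, Suc i mod n} | i. i < n}\<rparr>"

end

theory Submission
  imports Defs "HOL-Library.FuncSet"
begin

text \<open>
  The host graph joins every vertex on the left to one random vertex in each of \<open>R\<^sup>2\<close> blocks of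
  size \<open>n\<close> on the right, where \<open>R = 128 (4r)\<^sup>2\<^sup>8\<close>. A union bound over an exponential moment shows
  that no two large vertex sets span more than four times the expected number of edges. In a
  subgraph with a \<open>1/r\<close> fraction of the edges, a balanced pair \<open>(A, B)\<close> maximising the number
  of edges divided by \<open>\<bar>A\<bar> powr (2 - 1/28)\<close> therefore still has linear size, and by maximality
  every subset of one side of relative size \<open>1/128\<close> sends an edge to every subset of the other
  side of relative size \<open>1/4\<close>.

  Inside such a pair, depth-first search gives a path of linear length. After deleting
  a small non-expanding set, two vertices at distance \<open>l\<close> along this path are the roots of disjoint
  binary trees of depth \<open>h\<close> off the path, whose last layers are so large that they have a
  common neighbour. This closes a cycle of length \<open>l + 2h + 2\<close>, and \<open>l\<close> is any prescribed even
  number.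
\<close>

section \<open>Cycles in bipartite graphs without large holes\<close>

lemma contains_copy_cycleI:
  assumes "distinct cs" "length cs = n" "n \<ge> 3" "fin_graph J"
    and adj: "\<And>i. i < n \<Longrightarrow> {cs ! i, cs ! (Suc i mod n)} \<in> edges J"
  shows "contains_copy J (cycle_graph n)"
proof -
  \<comment> \<open>\<open>K\<close> carries only the edges of the cyclic list:
    \<open>isomorphic\<close> asks for an equivalence, which chords of \<open>J\<close> would
    break.\<close>
  define K where "K = \<lparr>verts = set cs, edges = {{cs ! i, cs ! (Suc i mod n)} | i. i < n}\<rparr>"
  define f where "f = inv_into {..<n} ((!) cs)"
  have bij: "bij_betw ((!) cs) {..<n} (set cs)"
    using assms(1,2) bij_betw_nth by blast
  have inj: "inj_on ((!) cs) {..<n}"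
    using bij by (simp add: bij_betw_def)
  have sub: "edges K \<subseteq> edges J"
    using adj by (auto simp: K_def)
  have "{cs ! i, cs ! j} \<in> edges K \<longleftrightarrow> {i, j} \<in> edges (cycle_graph n)"
    if ij: "i < n" "j < n" for i j
  proof -
    have "{cs ! i, cs ! j} = {cs ! l, cs ! (Suc l mod n)} \<longleftrightarrow> {i, j} = {l, Suc l mod n}"
      if "l < n" for l
    proof -
      have "(!) cs ` {i, j} = (!) cs ` {l, Suc l mod n} \<longleftrightarrow> {i, j} = {l, Suc l mod n}"
        using ij that assms(3) by (intro inj_on_image_eq_iff[OF inj]) auto
      then show ?thesis by simp
    qed
    then show ?thesis
      unfolding K_def cycle_graph_def by auto
  qed
  note nth_iso = this
  have f: "f u < n" "cs ! f u = u" if "u \<in> set cs" for u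
    using that bij inv_into_into[of u "(!) cs" "{..<n}"] f_inv_into_f[of u "(!) cs" "{..<n}"]
    by (auto simp: f_def bij_betw_def)
  have iso: "{u, v} \<in> edges K \<longleftrightarrow> {f u, f v} \<in> edges (cycle_graph n)"
    if "u \<in> set cs" "v \<in> set cs" for u v
    using nth_iso[of "f u" "f v"] that by (simp add: f)
  have "fin_graph K"
    unfolding fin_graph_def
  proof (intro conjI ballI)
    fix e assume e: "e \<in> edges K"
    show "card e = 2"
      using e sub assms(4) by (auto simp: fin_graph_def)
    obtain i where "i < n" "e = {cs ! i, cs ! (Suc i mod n)}"
      using e by (auto simp: K_def)
    then show "e \<subseteq> verts K"
      using assms(2,3) by (auto simp: K_def)
  qed (simp add: K_def)
  moreover have "set cs \<subseteq> verts J"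
  proof
    fix x assume "x \<in> set cs"
    then obtain i where "i < n" "x = cs ! i"
      using assms(2) by (metis in_set_conv_nth)
    then show "x \<in> verts J"
      using adj[of i] assms(4) unfolding fin_graph_def by blast
  qed
  ultimately have "subgraph K J"
    using sub by (simp add: subgraph_def K_def)
  moreover have "isomorphic K (cycle_graph n)"
    unfolding isomorphic_def
  proof (intro exI[of _ f] conjI ballI)
    show "bij_betw f (verts K) (verts (cycle_graph n))"
      using bij_betw_inv_into[OF bij] by (simp add: f_def K_def cycle_graph_def)
  qed (use iso in \<open>auto simp: K_def\<close>)
  ultimately show ?thesis
    unfolding contains_copy_def by blast
qed

text \<open>The thresholds \<open>k\<close> and \<open>s / 4\<close> differ, so joinedness is
  required in both orders. This makes the axioms symmetric in \<open>A\<close> and \<open>B\<close>,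
  and \<open>swapped\<close> turns each fact about one side into its mirror image.\<close>

locale joined_bipartite =
  fixes A B :: "'a set" and adj :: "'a \<Rightarrow> 'a \<Rightarrow> bool" and s k :: nat
  assumes finite: "finite A" "finite B"
    and card_sides: "card A = s" "card B = s"
    and disjoint: "A \<inter> B = {}"
    and adj_sym: "adj x y \<Longrightarrow> adj y x"
    and adj_sides: "adj x y \<Longrightarrow> x \<in> A \<and> y \<in> B \<or> x \<in> B \<and> y \<in> A"
    and joined_AB: "\<lbrakk>X \<subseteq> A; Y \<subseteq> B; k \<le> card X; s \<le> 4 * card Y\<rbrakk> \<Longrightarrow> \<exists>x\<in>X. \<exists>y\<in>Y. adj x y"
    and joined_BA: "\<lbrakk>X \<subseteq> B; Y \<subseteq> A; k \<le> card X; s \<le> 4 * card Y\<rbrakk> \<Longrightarrow> \<exists>x\<in>X. \<exists>y\<in>Y. adj x y"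
    and k_pos: "k > 0"
    and k_small: "100 * k \<le> s"
begin

lemma swapped: "joined_bipartite B A adj s k"
proof
  show "B \<inter> A = {}" using disjoint by blast
  show "x \<in> B \<and> y \<in> A \<or> x \<in> A \<and> y \<in> B" if "adj x y" for x y
    using adj_sides[OF that] by blast
qed (fact finite card_sides k_pos k_small | erule adj_sym joined_AB joined_BA; assumption)+

lemma card_verts: "card (A \<union> B) = 2 * s"
  using card_Un_disjoint[OF finite disjoint] card_sides by simp

lemma card_split:
  assumes "X \<subseteq> A \<union> B"
  shows "card X = card (X \<inter> A) + card (X \<inter> B)"
proof -
  have "X = (X \<inter> A) \<union> (X \<inter> B)" using assms by blast
  moreover have "card ((X \<inter> A) \<union> (X \<inter> B)) = card (X \<inter> A) + card (X \<inter> B)"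
    using finite disjoint by (intro card_Un_disjoint) auto
  ultimately show ?thesis by simp
qed

section \<open>Depth-first search and a long path\<close>

definition separation :: "'a set \<Rightarrow> 'a list \<Rightarrow> 'a set \<Rightarrow> bool" where
  "separation D xs U \<longleftrightarrow> D \<union> set xs \<union> U = A \<union> B \<and> D \<inter> U = {} \<and> D \<inter> set xs = {} \<and>
     U \<inter> set xs = {} \<and> distinct xs \<and> successively adj xs \<and>
     (\<forall>x\<in>D. \<forall>y\<in>U. \<not> adj x y) \<and> card D \<le> card U"

lemma separation_card:
  assumes "separation D xs U"
  shows "finite D" "finite U" "card D + length xs + card U = 2 * s"
proof -
  have *: "D \<union> set xs \<union> U = A \<union> B" "D \<inter> U = {}" "D \<inter> set xs = {}" "U \<inter> set xs = {}" "distinct xs"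
    using assms by (auto simp: separation_def)
  have fin: "finite (D \<union> set xs \<union> U)" using finite *(1) by simp
  then show "finite D" "finite U" by auto
  then have "card (D \<union> set xs \<union> U) = card D + card (set xs) + card U"
    using *(2-4) by (subst card_Un_disjoint; auto simp: card_Un_disjoint)
  then show "card D + length xs + card U = 2 * s"
    using card_verts *(1,5) by (simp add: distinct_card)
qed

text \<open>Depth-first search: \<open>D\<close> is the set of finished vertices, \<open>xs\<close> the stack and \<open>U\<close> the
  unvisited set. Each step raises \<open>2 * card D + length xs\<close> by one and lowers
  \<open>card U - card D\<close> by one, so a maximal separation has \<open>card D = card U\<close>.\<close>

lemma balanced_separation:
  obtains D xs U where "separation D xs U" "card D = card U"
proof -
  define m where "m = (\<lambda>(D :: 'a set, xs :: 'a list, U :: 'a set). 2 * card D + length xs)"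
  have start: "(\<lambda>(D, xs, U). separation D xs U) ({}, [], A \<union> B)"
    by (simp add: separation_def)
  have "\<forall>p. (\<lambda>(D, xs, U). separation D xs U) p \<longrightarrow> m p < Suc (4 * s)"
    using separation_card(3) by (fastforce simp: m_def)
  from ex_has_greatest_nat[of "\<lambda>(D, xs, U). separation D xs U", OF start this]
  obtain p where p: "(\<lambda>(D, xs, U). separation D xs U) p"
    "\<forall>q. (\<lambda>(D, xs, U). separation D xs U) q \<longrightarrow> m q \<le> m p"
    by blast
  obtain D xs U where "p = (D, xs, U)" by (cases p)
  then have sep: "separation D xs U"
    and max: "\<And>D' xs' U'. separation D' xs' U' \<Longrightarrow> 2 * card D' + length xs' \<le> 2 * card D + length xs"
    using p by (auto simp: m_def)
  note fin = separation_card(1,2)[OF sep]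
  have "\<not> card D < card U"
  proof
    assume lt: "card D < card U"
    \<comment> \<open>Push if the stack is empty or its top has an unvisited neighbour; otherwise
      the top has no neighbour in \<open>U\<close> and moves to \<open>D\<close>. As
      \<open>card D < card U\<close>, both moves keep \<open>card D \<le> card U\<close>.\<close>
    show False
    proof (cases "\<exists>y\<in>U. xs = [] \<or> adj y (hd xs)")
      case True
      then obtain y where y: "y \<in> U" "xs = [] \<or> adj y (hd xs)" by blast
      have "card (U - {y}) = card U - 1" using y fin by simp
      then have "separation D (y # xs) (U - {y})"
        using sep y lt unfolding separation_def by (auto simp: successively_Cons)
      from max[OF this] show False by simp
    next
      case False
      moreover have "U \<noteq> {}" using lt by auto
      ultimately obtain x ys where xs: "xs = x # ys" by (cases xs) auto
      have nx: "\<not> adj x y" if "y \<in> U" for y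
        using that False xs adj_sym by auto
      have x: "x \<notin> D" using sep xs by (auto simp: separation_def)
      then have "separation (insert x D) ys U"
        using sep nx lt fin unfolding separation_def xs by (auto simp: successively_Cons)
      from max[OF this] x fin show False by (simp add: xs)
    qed
  qed
  moreover have "card D \<le> card U" using sep by (simp add: separation_def)
  ultimately show ?thesis using that sep by simp
qed

lemma long_path:
  obtains xs where "set xs \<subseteq> A \<union> B" "distinct xs" "successively adj xs" "s \<le> 4 * length xs"
    "4 * length xs \<le> s + 4"
proof -
  obtain D xs U where sep: "separation D xs U" and eq: "card D = card U"
    by (rule balanced_separation)
  note fin = separation_card[OF sep]
  have no: "\<not> adj x y" if "x \<in> D" "y \<in> U" for x y
    using sep that by (auto simp: separation_def)
  have sub: "D \<subseteq> A \<union> B" "U \<subseteq> A \<union> B" "D \<inter> U = {}" using sep by (auto simp: separation_def)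
  note D = card_split[OF sub(1)] and U = card_split[OF sub(2)]
  have a: "card (D \<inter> A) + card (U \<inter> A) \<le> s"
    using sub finite card_sides card_mono[of A "D \<inter> A \<union> U \<inter> A"]
    by (subst card_Un_disjoint[symmetric]) auto
  have b: "card (D \<inter> B) + card (U \<inter> B) \<le> s"
    using sub finite card_sides card_mono[of B "D \<inter> B \<union> U \<inter> B"]
    by (subst card_Un_disjoint[symmetric]) auto
  have j1: "\<not> (k \<le> card (D \<inter> A) \<and> s \<le> 4 * card (U \<inter> B))"
    using joined_AB[of "D \<inter> A" "U \<inter> B"] no by blast
  have j2: "\<not> (k \<le> card (D \<inter> B) \<and> s \<le> 4 * card (U \<inter> A))"
    using joined_BA[of "D \<inter> B" "U \<inter> A"] no by blast
  \<comment> \<open>A shorter stack leaves \<open>card D = card U > 7 * s / 8\<close>.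
    \<open>D\<close> has \<open>k\<close> vertices on some side, so \<open>U\<close> has fewer than
    \<open>s / 4\<close> on the opposite one and more than \<open>5 * s / 8\<close> on the same one.
    Then \<open>D\<close> has fewer than \<open>k\<close> on the opposite side, and \<open>D\<close>
    and \<open>U\<close> together overfill the first side.\<close>
  have len: "s \<le> 4 * length xs"
  proof (rule ccontr)
    assume "\<not> s \<le> 4 * length xs"
    then show False
      using j1 j2 a b D U eq fin(3) k_small by linarith
  qed
  \<comment> \<open>Cutting the path to the ceiling of \<open>s / 4\<close> vertices keeps most of
    the graph free for the trees.\<close>
  define ys where "ys = take ((s + 3) div 4) xs"
  have "length ys = (s + 3) div 4" using len by (simp add: ys_def)
  moreover have "xs = ys @ drop ((s + 3) div 4) xs" by (simp add: ys_def)
  then have "successively adj ys"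
    using sep unfolding separation_def by (metis successively_append_iff)
  moreover have "set ys \<subseteq> A \<union> B" "distinct ys"
    using sep set_take_subset[of _ xs] by (fastforce simp: separation_def ys_def)+
  ultimately show ?thesis using that[of ys] by force
qed

section \<open>Expansion outside a small set\<close>

definition nbrs :: "'a set \<Rightarrow> 'a set \<Rightarrow> 'a set" where
  "nbrs W X = {w \<in> W. \<exists>x\<in>X. adj x w}"

text \<open>The vertices of \<open>B\<close> outside the neighbourhood send no edge to
  \<open>X\<close>, so there are fewer than \<open>s / 4\<close> of them.\<close>

lemma card_nbrs_side:
  assumes "k \<le> card X" "X \<subseteq> A"
  shows "3 * s \<le> 4 * card (nbrs B X)"
proof -
  have "\<not> s \<le> 4 * card (B - nbrs B X)"
    using joined_AB[of X "B - nbrs B X"] assms by (auto simp: nbrs_def)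
  moreover have "card (B - nbrs B X) = s - card (nbrs B X)"
    using finite card_sides by (subst card_Diff_subset) (auto simp: nbrs_def)
  ultimately show ?thesis by linarith
qed

lemma nbrs_large:
  assumes X: "2 * k \<le> card X" "X \<subseteq> A \<union> B" and W: "W = A \<union> B - Q" "finite Q"
  shows "3 * s \<le> 4 * card (nbrs W X) + 4 * card Q"
proof -
  interpret sw: joined_bipartite B A adj s k by (rule swapped)
  have finX: "finite X" using X(2) finite finite_subset by blast
  have fn: "finite (nbrs W X)" using W finite by (simp add: nbrs_def)
  have "card X = card (X \<inter> A) + card (X \<inter> B)"
    by (rule card_split[OF X(2)])
  then consider "k \<le> card (X \<inter> A)" | "k \<le> card (X \<inter> B)"
    using X(1) by linarith
  then have "\<exists>Z. 3 * s \<le> 4 * card Z \<and> Z \<subseteq> nbrs W X \<union> Q"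
  proof cases
    case 1
    then show ?thesis using card_nbrs_side[of "X \<inter> A"] W
      by (intro exI[of _ "nbrs B (X \<inter> A)"]) (auto simp: nbrs_def)
  next
    case 2
    then show ?thesis using sw.card_nbrs_side[of "X \<inter> B"] W
      by (intro exI[of _ "sw.nbrs A (X \<inter> B)"]) (auto simp: nbrs_def sw.nbrs_def)
  qed
  then obtain Z where Z: "3 * s \<le> 4 * card Z" "Z \<subseteq> nbrs W X \<union> Q" by blast
  have "card Z \<le> card (nbrs W X) + card Q"
    using Z(2) fn W(2) card_mono[of "nbrs W X \<union> Q" Z] card_Un_le[of "nbrs W X" Q] by simp
  then show ?thesis using Z(1) by linarith
qed

text \<open>\<open>S\<close> is a largest non-expanding set: a further non-expanding
  \<open>X\<close> outside it could be merged into it, contradicting maximality.\<close>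

lemma expanding_core:
  assumes W: "W = A \<union> B - Q" "finite Q" "4 * card Q \<le> s + 4"
  obtains S where "S \<subseteq> A \<union> B" "card S < 2 * k"
    "\<And>X. \<lbrakk>X \<subseteq> A \<union> B - S; X \<noteq> {}; card X \<le> 2 * k\<rbrakk> \<Longrightarrow> 8 * card X < card (nbrs W X - S)"
proof -
  \<comment> \<open>The cap \<open>4 * k\<close> leaves room for the union of \<open>S\<close>,
    below \<open>2 * k\<close>, with an \<open>X\<close> of size at most
    \<open>2 * k\<close>.\<close>
  define bad where "bad S \<longleftrightarrow> S \<subseteq> A \<union> B \<and> card S \<le> 4 * k \<and> card (nbrs W S - S) \<le> 8 * card S" for S
  have "bad {}" by (simp add: bad_def nbrs_def)
  moreover have "\<forall>S. bad S \<longrightarrow> card S < Suc (4 * k)" by (simp add: bad_def)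
  ultimately obtain S where S: "bad S" and max: "\<And>S'. bad S' \<Longrightarrow> card S' \<le> card S"
    using ex_has_greatest_nat[of bad _ card "Suc (4 * k)"] by blast
  have fin: "finite X" if "X \<subseteq> A \<union> B" for X
    using that finite finite_subset by blast
  \<comment> \<open>Otherwise \<open>nbrs_large\<close> gives at least \<open>s / 2 - 1\<close>,
    hence \<open>50 * k - 1\<close>, neighbours in \<open>W\<close>, whereas a bad set has at most
    \<open>8 * 4 * k + 4 * k\<close>.\<close>
  have small: "card S < 2 * k"
  proof (rule ccontr)
    assume "\<not> card S < 2 * k"
    then have "3 * s \<le> 4 * card (nbrs W S) + 4 * card Q"
      using S W by (intro nbrs_large) (auto simp: bad_def)
    moreover have "card (nbrs W S) - card S \<le> card (nbrs W S - S)"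
      by (rule diff_card_le_card_Diff) (use fin S in \<open>auto simp: bad_def\<close>)
    ultimately show False
      using S[unfolded bad_def] W(3) k_small k_pos by linarith
  qed
  show ?thesis
  proof (rule that[OF _ small])
    show "S \<subseteq> A \<union> B" using S by (simp add: bad_def)
    fix X assume X: "X \<subseteq> A \<union> B - S" "X \<noteq> {}" "card X \<le> 2 * k"
    show "8 * card X < card (nbrs W X - S)"
    proof (rule ccontr)
      assume "\<not> 8 * card X < card (nbrs W X - S)"
      moreover have c: "card (S \<union> X) = card S + card X"
        using X S fin by (intro card_Un_disjoint) (auto simp: bad_def)
      moreover have "card (nbrs W (S \<union> X) - (S \<union> X)) \<le> card ((nbrs W S - S) \<union> (nbrs W X - S))"
        using W finite by (intro card_mono) (auto simp: nbrs_def)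
      moreover have "\<dots> \<le> card (nbrs W S - S) + card (nbrs W X - S)"
        by (rule card_Un_le)
      ultimately have "bad (S \<union> X)"
        using S X small unfolding bad_def by auto
      then have "card X = 0" using max c by fastforce
      moreover have "finite X" using X(1) fin by blast
      ultimately show False using X(2) by simp
    qed
  qed
qed

section \<open>Disjoint trees grown off the path\<close>

lemma path_alternates:
  assumes "successively adj xs" "i < length xs"
  shows "xs ! i \<in> A \<longleftrightarrow> (hd xs \<in> A \<longleftrightarrow> even i)"
  using assms
proof (induction xs arbitrary: i)
  case (Cons x xs)
  show ?case
  proof (cases i)
    case (Suc j)
    then have "xs \<noteq> []" using Cons.prems by auto
    then have "adj x (hd xs)" "successively adj xs"
      using Cons.prems by (auto simp: successively_Cons)
    moreover have "x \<in> A \<longleftrightarrow> hd xs \<notin> A"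
      using adj_sides[OF calculation(1)] disjoint by blast
    ultimately show ?thesis using Cons Suc by auto
  qed simp
qed simp

text \<open>The index \<open>i\<close> counts edges. A tree is recorded only by its vertex set
  \<open>U\<close> and the ends of its branches; confining branches to \<open>U\<close> makes
  branches of disjoint trees disjoint.\<close>

definition reach :: "'a set \<Rightarrow> 'a \<Rightarrow> nat \<Rightarrow> 'a \<Rightarrow> bool" where
  "reach U u i x \<longleftrightarrow> (\<exists>p. successively adj p \<and> distinct p \<and> hd p = u \<and> last p = x \<and>
     length p = Suc i \<and> set p \<subseteq> U)"

lemma reach_step:
  assumes "reach U u i x" "adj x y" "y \<notin> U" "insert y U \<subseteq> U'"
  shows "reach U' u (Suc i) y"
proof -
  obtain p where p: "successively adj p" "distinct p" "hd p = u" "last p = x"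
    "length p = Suc i" "set p \<subseteq> U"
    using assms(1) unfolding reach_def by blast
  then have "p \<noteq> []" by auto
  then show ?thesis
    unfolding reach_def using p assms
    by (intro exI[of _ "p @ [y]"]) (auto simp: successively_append_iff)
qed

text \<open>Both trees grow by one level at a time. The bound on \<open>card U1 + card U2\<close> is
  the size of two full binary trees, \<open>2 * (2 ^ (i + 1) - 1)\<close>.\<close>

lemma two_disjoint_trees:
  assumes expand: "\<And>X. \<lbrakk>X \<subseteq> A \<union> B - S; X \<noteq> {}; card X \<le> 2 * k\<rbrakk> \<Longrightarrow> 8 * card X < card (nbrs W X - S)"
    and W: "W \<subseteq> A \<union> B" and uv: "u \<in> A \<union> B - S - W" "v \<in> A \<union> B - S - W" "u \<noteq> v"
    and "2 ^ i \<le> 2 * k"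
  shows "\<exists>X Y U1 U2. X \<subseteq> U1 \<and> Y \<subseteq> U2 \<and> U1 \<inter> U2 = {} \<and>
    U1 \<subseteq> insert u (W - S) \<and> U2 \<subseteq> insert v (W - S) \<and>
    card X = 2 ^ i \<and> card Y = 2 ^ i \<and> card U1 + card U2 + 2 \<le> 4 * 2 ^ i \<and>
    (\<forall>x\<in>X. reach U1 u i x) \<and> (\<forall>y\<in>Y. reach U2 v i y)"
  using assms(6)
proof (induction i)
  case 0
  have "reach {z} z 0 z" for z
    unfolding reach_def by (rule exI[of _ "[z]"]) simp
  then show ?case using uv(3)
    by (intro exI[of _ "{u}"] exI[of _ "{v}"]) auto
next
  case (Suc i)
  have i: "2 * 2 ^ i \<le> 2 * k" using Suc.prems by simp
  then obtain X Y U1 U2 where XY: "X \<subseteq> U1" "Y \<subseteq> U2" "U1 \<inter> U2 = {}"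
    "U1 \<subseteq> insert u (W - S)" "U2 \<subseteq> insert v (W - S)" "card X = 2 ^ i" "card Y = 2 ^ i"
    "card U1 + card U2 + 2 \<le> 4 * 2 ^ i"
    "\<And>x. x \<in> X \<Longrightarrow> reach U1 u i x" "\<And>y. y \<in> Y \<Longrightarrow> reach U2 v i y"
    using Suc.IH by fastforce
  have finW: "finite W" using W finite finite_subset by blast
  then have fin: "finite U1" "finite U2"
    using XY(4,5) by (meson finite_Diff finite_insert finite_subset)+
  have ne: "X \<noteq> {}" "Y \<noteq> {}" using XY(6,7) by auto
  have XS: "X \<subseteq> A \<union> B - S" "Y \<subseteq> A \<union> B - S"
    using XY(1,2,4,5) uv W by blast+
  have cU: "card (U1 \<union> U2) \<le> 4 * 2 ^ i"
    using card_Un_le[of U1 U2] XY(8) by linarith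
  \<comment> \<open>Expansion by 8 is what one level takes: up to \<open>4 * 2 ^ i\<close> vertices
    are already used, the new level \<open>X'\<close> uses \<open>2 * 2 ^ i\<close> more, and
    \<open>2 * 2 ^ i\<close> must remain for \<open>Y'\<close>.\<close>
  have big: "8 * 2 ^ i < card (nbrs W X - S)" "8 * 2 ^ i < card (nbrs W Y - S)"
    using expand[OF XS(1) ne(1)] expand[OF XS(2) ne(2)] XY(6,7) i by simp_all
  have "card (nbrs W X - S) - card (U1 \<union> U2) \<le> card (nbrs W X - S - (U1 \<union> U2))"
    by (rule diff_card_le_card_Diff) (use fin in simp)
  then have "2 * 2 ^ i \<le> card (nbrs W X - S - (U1 \<union> U2))"
    using big cU by linarith
  then obtain X' where X': "X' \<subseteq> nbrs W X - S - (U1 \<union> U2)" "card X' = 2 * 2 ^ i" "finite X'"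
    by (rule obtain_subset_with_card_n)
  have "card (U1 \<union> U2 \<union> X') \<le> 6 * 2 ^ i"
    using card_Un_le[of "U1 \<union> U2" X'] X'(2) cU by linarith
  moreover have "card (nbrs W Y - S) - card (U1 \<union> U2 \<union> X') \<le> card (nbrs W Y - S - (U1 \<union> U2 \<union> X'))"
    by (rule diff_card_le_card_Diff) (use fin X' in simp)
  ultimately have "2 * 2 ^ i \<le> card (nbrs W Y - S - (U1 \<union> U2 \<union> X'))"
    using big by linarith
  then obtain Y' where Y': "Y' \<subseteq> nbrs W Y - S - (U1 \<union> U2 \<union> X')" "card Y' = 2 * 2 ^ i" "finite Y'"
    by (rule obtain_subset_with_card_n)
  have rX: "reach (U1 \<union> X') u (Suc i) x" if x: "x \<in> X'" for x
  proof -
    obtain z where "z \<in> X" "adj z x" using x X' by (auto simp: nbrs_def)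
    then show ?thesis using x X' by (intro reach_step[OF XY(9), of z x]) auto
  qed
  have rY: "reach (U2 \<union> Y') v (Suc i) x" if x: "x \<in> Y'" for x
  proof -
    obtain z where "z \<in> Y" "adj z x" using x Y' by (auto simp: nbrs_def)
    then show ?thesis using x Y' by (intro reach_step[OF XY(10), of z x]) auto
  qed
  have "card (U1 \<union> X') + card (U2 \<union> Y') + 2 \<le> 4 * 2 ^ Suc i"
    using card_Un_le[of U1 X'] card_Un_le[of U2 Y'] X'(2) Y'(2) XY(8) by simp
  moreover have "(U1 \<union> X') \<inter> (U2 \<union> Y') = {}"
    using XY(3) X'(1) Y'(1) by blast
  moreover have "U1 \<union> X' \<subseteq> insert u (W - S)" "U2 \<union> Y' \<subseteq> insert v (W - S)"
    using XY(4,5) X'(1) Y'(1) by (auto simp: nbrs_def)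
  ultimately show ?case
    using X'(2) Y'(2) rX rY
    by (intro exI[of _ X'] exI[of _ Y'] exI[of _ "U1 \<union> X'"] exI[of _ "U2 \<union> Y'"]) simp
qed

section \<open>Closing a cycle of prescribed length\<close>

text \<open>Each neighbourhood covers three quarters of \<open>B\<close>, so the two share at least
  half of it, more than \<open>Z\<close> can block.\<close>

lemma common_neighbour:
  assumes X: "k \<le> card X" "X \<subseteq> A" and Y: "k \<le> card Y" "Y \<subseteq> A"
    and Z: "finite Z" "2 * card Z < s"
  obtains x y w where "x \<in> X" "y \<in> Y" "w \<in> B - Z" "adj x w" "adj y w"
proof -
  have fin: "finite (nbrs B X)" "finite (nbrs B Y)" using finite by (simp_all add: nbrs_def)
  have "card (nbrs B X \<union> nbrs B Y) \<le> s"
    using finite card_sides card_mono[of B "nbrs B X \<union> nbrs B Y"] by (auto simp: nbrs_def)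
  then have "s \<le> 2 * card (nbrs B X \<inter> nbrs B Y)"
    using card_nbrs_side[OF X] card_nbrs_side[OF Y] card_Un_Int[OF fin] by linarith
  then have "\<not> nbrs B X \<inter> nbrs B Y \<subseteq> Z"
    using card_mono[OF Z(1), of "nbrs B X \<inter> nbrs B Y"] Z(2) by linarith
  then show ?thesis using that by (fastforce simp: nbrs_def)
qed

text \<open>There are at least \<open>s / 4 - l\<close>, hence \<open>24 * k\<close>, starting
  positions, and each vertex of \<open>S\<close> spoils at most two: one as first end and one as
  second end.\<close>

lemma spread_pair_on_path:
  assumes "distinct xs" "card S < 2 * k" "finite S" "s \<le> 4 * length xs" "100 * l \<le> s"
  obtains i where "i + l < length xs" "xs ! i \<notin> S" "xs ! (i + l) \<notin> S"
proof -
  define I where "I = {i. i + l < length xs}"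
  have I: "I = {..<length xs - l}" by (auto simp: I_def)
  define I1 where "I1 = {i \<in> I. xs ! i \<in> S}"
  define I2 where "I2 = {i \<in> I. xs ! (i + l) \<in> S}"
  have "card I1 \<le> card S"
    by (rule card_inj_on_le[of "(!) xs"])
       (use assms in \<open>auto simp: I1_def I_def inj_on_def nth_eq_iff_index_eq\<close>)
  moreover have "card I2 \<le> card S"
    by (rule card_inj_on_le[of "\<lambda>i. xs ! (i + l)"])
       (use assms in \<open>auto simp: I2_def I_def inj_on_def nth_eq_iff_index_eq\<close>)
  ultimately have "card (I1 \<union> I2) < 4 * k"
    using card_Un_le[of I1 I2] assms(2) by linarith
  moreover have "4 * k \<le> card I"
    using assms(4,5) k_small by (simp add: I)
  moreover have "finite (I1 \<union> I2)"
    by (simp add: I1_def I2_def I)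
  ultimately have "\<not> I \<subseteq> I1 \<union> I2"
    using card_mono[of "I1 \<union> I2" I] by linarith
  then obtain i where "i \<in> I" "i \<notin> I1" "i \<notin> I2" by blast
  then show ?thesis using that[of i] by (auto simp: I_def I1_def I2_def)
qed

lemma reach_side:
  assumes "reach U u i x"
  shows "x \<in> A \<longleftrightarrow> (u \<in> A \<longleftrightarrow> even i)"
proof -
  obtain p where p: "successively adj p" "hd p = u" "last p = x" "length p = Suc i"
    using assms unfolding reach_def by blast
  then have "p \<noteq> []" by auto
  then have "p ! i = x" using p by (simp add: last_conv_nth)
  then show ?thesis using path_alternates[OF p(1), of i] p by simp
qed

lemma close_cycle:
  assumes z: "successively adj z" "distinct z" "z \<noteq> []"
    and x: "reach U1 (hd z) h x" and y: "reach U2 (last z) h y"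
    and disj: "U1 \<inter> U2 = {}" "U1 \<inter> set z \<subseteq> {hd z}" "U2 \<inter> set z \<subseteq> {last z}"
    and w: "w \<notin> set z \<union> U1 \<union> U2" "adj x w" "adj y w"
  shows "\<exists>cs. distinct cs \<and> length cs = length z + 2 * h + 1 \<and> successively adj cs \<and> adj (last cs) (hd cs)"
proof -
  obtain p where p: "successively adj p" "distinct p" "hd p = hd z" "last p = x"
    "length p = Suc h" "set p \<subseteq> U1"
    using x unfolding reach_def by blast
  obtain q where q: "successively adj q" "distinct q" "hd q = last z" "last q = y"
    "length q = Suc h" "set q \<subseteq> U2"
    using y unfolding reach_def by blast
  obtain p' where p': "p = hd z # p'" using p(3,5) by (cases p) auto
  obtain q' where q': "q = last z # q'" using q(3,5) by (cases q) auto
  \<comment> \<open>The cycle follows \<open>z\<close>, descends the second tree to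
    \<open>y\<close>, passes through \<open>w\<close> and climbs the first tree back. The tails
    \<open>p'\<close> and \<open>q'\<close> omit the roots, which lie on \<open>z\<close>.\<close>
  define cs where "cs = z @ q' @ [w] @ rev p'"
  have ql: "last (z @ q') = y"
    using q(4) q' z(3) by (cases "q' = []") auto
  have zq: "successively adj (z @ q')"
    using z q(1) q' by (auto simp: successively_append_iff successively_Cons)
  have pw: "successively adj (w # rev p')"
  proof -
    have "successively adj (rev p')"
      using p(1) p' adj_sym by (auto simp: successively_Cons intro: successively_mono)
    moreover have "p' \<noteq> [] \<Longrightarrow> hd (rev p') = x"
      using p(4) p' by (simp add: hd_rev)
    ultimately show ?thesis using adj_sym[OF w(2)] by (auto simp: successively_Cons)
  qed
  have "successively adj ((z @ q') @ (w # rev p'))"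
    using zq pw ql w(3) z(3) by (subst successively_append_iff) auto
  moreover have "adj (last cs) (hd cs)"
  proof (cases "p' = []")
    case True
    then show ?thesis using p(4) p' adj_sym[OF w(2)] z(3) by (simp add: cs_def)
  next
    case False
    then show ?thesis using p(1) p' z(3) adj_sym by (auto simp: cs_def successively_Cons last_rev)
  qed
  moreover have "distinct cs"
  proof -
    have "hd z \<notin> set p'" "last z \<notin> set q'" "distinct p'" "distinct q'" "set p' \<subseteq> U1" "set q' \<subseteq> U2"
      using p(2,6) q(2,6) p' q' by auto
    then show ?thesis using z(2) disj w(1) unfolding cs_def by auto
  qed
  moreover have "length cs = length z + 2 * h + 1"
    using p(5) q(5) p' q' by (simp add: cs_def)
  ultimately show ?thesis by (intro exI[of _ cs]) (simp add: cs_def)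
qed

lemma cycle_exists:
  assumes n: "even n" "100 * n \<le> s" and h: "k \<le> 2 ^ h" "2 ^ h \<le> 2 * k" "2 * h + 4 \<le> n"
  shows "\<exists>cs. distinct cs \<and> length cs = n \<and> successively adj cs \<and> adj (last cs) (hd cs)"
proof -
  interpret sw: joined_bipartite B A adj s k by (rule swapped)
  obtain xs where xs: "set xs \<subseteq> A \<union> B" "distinct xs" "successively adj xs"
    "s \<le> 4 * length xs" "4 * length xs \<le> s + 4"
    by (rule long_path)
  define W where "W = A \<union> B - set xs"
  obtain S where S: "S \<subseteq> A \<union> B" "card S < 2 * k"
    "\<And>X. \<lbrakk>X \<subseteq> A \<union> B - S; X \<noteq> {}; card X \<le> 2 * k\<rbrakk> \<Longrightarrow> 8 * card X < card (nbrs W X - S)"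
    by (rule expanding_core[of W "set xs"]) (use xs in \<open>auto simp: W_def distinct_card\<close>)
  have finS: "finite S" using S(1) finite finite_subset by blast
  \<comment> \<open>The path segment contributes \<open>l + 1\<close> vertices, the two branches
    \<open>h\<close> each and \<open>w\<close> one, in total \<open>n\<close>.\<close>
  define l where "l = n - 2 * h - 2"
  have l: "even l" "l > 0" "n = l + 2 * h + 2" using n(1) h(3) by (auto simp: l_def)
  obtain i where i: "i + l < length xs" "xs ! i \<notin> S" "xs ! (i + l) \<notin> S"
    by (rule spread_pair_on_path[OF xs(2) S(2) finS xs(4), of l]) (use l n in auto)
  define z where "z = take (Suc l) (drop i xs)"
  have z: "length z = Suc l" "z \<noteq> []" using i(1) by (auto simp: z_def)
  have hz: "hd z = xs ! i" using i(1) z by (simp add: z_def hd_drop_conv_nth)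
  have lz: "last z = xs ! (i + l)" using i(1) z by (simp add: last_conv_nth) (simp add: z_def)
  have "xs = take i xs @ z @ drop (Suc l) (drop i xs)"
    unfolding z_def by (metis append_take_drop_id)
  then have zp: "successively adj z" "distinct z" "set z \<subseteq> set xs"
    using xs(2,3) by (metis successively_append_iff, metis distinct_append, metis Un_iff set_append subsetI)
  have ne: "xs ! i \<noteq> xs ! (i + l)"
    using i(1) l xs(2) by (simp add: nth_eq_iff_index_eq)
  have "xs ! i \<in> A \<union> B" "xs ! (i + l) \<in> A \<union> B"
    using i(1) by (auto intro!: subsetD[OF xs(1)] simp del: Un_iff)
  then have uv: "hd z \<in> A \<union> B - S - W" "last z \<in> A \<union> B - S - W"
    using i by (auto simp: hz lz W_def)
  obtain X Y U1 U2 where T: "X \<subseteq> U1" "Y \<subseteq> U2" "U1 \<inter> U2 = {}"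
    "U1 \<subseteq> insert (hd z) (W - S)" "U2 \<subseteq> insert (last z) (W - S)" "card X = 2 ^ h" "card Y = 2 ^ h"
    "card U1 + card U2 + 2 \<le> 4 * 2 ^ h"
    "\<And>x. x \<in> X \<Longrightarrow> reach U1 (hd z) h x" "\<And>y. y \<in> Y \<Longrightarrow> reach U2 (last z) h y"
    using two_disjoint_trees[OF S(3) _ uv _ h(2)] ne by (auto simp: hz lz W_def)
  \<comment> \<open>Since \<open>l\<close> is even, both roots lie on one side, and so do the last
    layers of both trees, as a common neighbour requires.\<close>
  have same: "hd z \<in> A \<longleftrightarrow> last z \<in> A"
    using path_alternates[OF zp(1), of l] z l(1) by (simp add: last_conv_nth)
  have fin: "finite U1" "finite U2"
    using finite_subset[OF T(4)] finite_subset[OF T(5)] finite by (simp_all add: W_def)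
  define Z where "Z = set xs \<union> U1 \<union> U2"
  have Z: "finite Z" "2 * card Z < s"
  proof -
    show "finite Z" using fin by (simp add: Z_def)
    have "card Z \<le> length xs + card U1 + card U2"
      using card_Un_le[of "set xs \<union> U1" U2] card_Un_le[of "set xs" U1] card_length[of xs]
      unfolding Z_def by linarith
    \<comment> \<open>The path takes at most \<open>s / 4 + 1\<close> vertices and the trees at most
      \<open>8 * k - 2\<close>, together less than \<open>s / 2\<close>.\<close>
    then show "2 * card Z < s" using T(8) h(2) xs(5) k_small k_pos by linarith
  qed
  have sub: "X \<subseteq> A \<union> B" "Y \<subseteq> A \<union> B"
    using T(1,2,4,5) uv by (auto simp: W_def)
  have "X \<subseteq> A \<and> Y \<subseteq> A \<or> X \<subseteq> B \<and> Y \<subseteq> B"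
    using reach_side[OF T(9)] reach_side[OF T(10)] same sub by blast
  then have "\<exists>x y w. x \<in> X \<and> y \<in> Y \<and> w \<notin> Z \<and> adj x w \<and> adj y w"
  proof
    assume "X \<subseteq> A \<and> Y \<subseteq> A"
    then show ?thesis using common_neighbour[of X Y Z] T(6,7) h(1) Z by (metis DiffD2)
  next
    assume "X \<subseteq> B \<and> Y \<subseteq> B"
    then show ?thesis using sw.common_neighbour[of X Y Z] T(6,7) h(1) Z by (metis DiffD2)
  qed
  then obtain x y w where w: "x \<in> X" "y \<in> Y" "w \<notin> Z" "adj x w" "adj y w" by blast
  have "\<exists>cs. distinct cs \<and> length cs = length z + 2 * h + 1 \<and> successively adj cs \<and> adj (last cs) (hd cs)"
  proof (rule close_cycle[OF zp(1,2) z(2) T(9)[OF w(1)] T(10)[OF w(2)] T(3)])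
    show "U1 \<inter> set z \<subseteq> {hd z}" "U2 \<inter> set z \<subseteq> {last z}"
      using T(4,5) zp(3) by (auto simp: W_def)
    show "w \<notin> set z \<union> U1 \<union> U2" using w(3) zp(3) by (auto simp: Z_def)
  qed (fact w)+
  then show ?thesis using z(1) l(3) by simp
qed

end

section \<open>Density increment\<close>

text \<open>Averaging: discarding an element with the least value of \<open>f\<close> does not lower
  the mean.\<close>

lemma heavy_subset:
  fixes f :: "'a \<Rightarrow> nat"
  assumes "finite B" "j \<le> card B"
  obtains B' where "B' \<subseteq> B" "card B' = j" "j * sum f B \<le> card B * sum f B'"
proof -
  have "\<exists>B'\<subseteq>B. card B' = j \<and> j * sum f B \<le> card B * sum f B'"
    using assms
  proof (induction "card B - j" arbitrary: B)
    case 0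
    then show ?case by (intro exI[of _ B]) auto
  next
    case (Suc m)
    then have "B \<noteq> {}" by auto
    then obtain x where x: "x \<in> B" "\<And>y. y \<in> B \<Longrightarrow> f x \<le> f y"
      using arg_min_if_finite[OF Suc.prems(1), of f] by (metis not_le)
    have c: "card (B - {x}) = card B - 1" "card B > j" "finite (B - {x})"
      using x Suc by auto
    have h: "m = card (B - {x}) - j" "j \<le> card (B - {x})"
      using c Suc.hyps(2) by linarith+
    obtain B' where B': "B' \<subseteq> B - {x}" "card B' = j" "j * sum f (B - {x}) \<le> (card B - 1) * sum f B'"
      using Suc.hyps(1)[OF h(1) c(3) h(2)] unfolding c(1) by blast
    have "sum (\<lambda>_. f x) B' \<le> sum f B'"
      by (rule sum_mono) (use x(2) B'(1) in auto)
    then have "j * f x \<le> sum f B'" using B'(2) by simp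
    moreover have "j * sum f B = j * f x + j * sum f (B - {x})"
      using x(1) Suc.prems(1) by (simp add: sum.remove distrib_left)
    moreover have "card B * sum f B' = sum f B' + (card B - 1) * sum f B'"
      using c(2) by (cases "card B") auto
    ultimately show ?case using B' by (intro exI[of _ B']) auto
  qed
  then show ?thesis using that by blast
qed

lemma card_Int_Times:
  assumes "finite X" "finite Y"
  shows "card (E \<inter> X \<times> Y) = (\<Sum>y\<in>Y. card {x \<in> X. (x, y) \<in> E})"
proof -
  have "E \<inter> X \<times> Y = (\<lambda>(y, x). (x, y)) ` (SIGMA y:Y. {x \<in> X. (x, y) \<in> E})"
    by auto
  moreover have "inj_on (\<lambda>(y, x). (x, y)) (SIGMA y:Y. {x \<in> X. (x, y) \<in> E})"
    by (auto simp: inj_on_def)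
  ultimately show ?thesis
    using assms by (simp add: card_image card_SigmaI)
qed

text \<open>\<open>heavy_subset\<close> applied to degrees into \<open>X\<close>. It shrinks a
  rectangle to one with equal sides, the only kind that the maximality hypotheses control.\<close>

lemma dense_subset:
  assumes "finite X" "finite Y" "j \<le> card Y"
  obtains Y' where "Y' \<subseteq> Y" "card Y' = j" "j * card (E \<inter> X \<times> Y) \<le> card Y * card (E \<inter> X \<times> Y')"
proof -
  obtain Y' where Y': "Y' \<subseteq> Y" "card Y' = j"
    "j * (\<Sum>y\<in>Y. card {x \<in> X. (x, y) \<in> E}) \<le> card Y * (\<Sum>y\<in>Y'. card {x \<in> X. (x, y) \<in> E})"
    using heavy_subset[OF assms(2,3)] by blast
  have "finite Y'" using Y'(1) assms(2) finite_subset by blast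
  then show ?thesis using that[of Y'] Y' assms(1,2) by (simp add: card_Int_Times)
qed

section \<open>A large hole contradicts maximality\<close>

text \<open>Here \<open>x\<close> is \<open>k / s\<close> for a hole with sides \<open>k\<close> and
  \<open>s / 4\<close>, and \<open>3 / 4\<close> is the share of the longer side left outside it.
  The linear bounds \<open>1 - 24 / 25 * x\<close> and \<open>6 / 5 * x\<close> suffice because
  \<open>3 / 4 * (6 / 5) < 24 / 25\<close>.\<close>

lemma powr_hole_ineq:
  fixes x :: real
  assumes "1 / 128 \<le> x" "x \<le> 1 / 50"
  shows "(1 - x) powr (27 / 28) + 3 / 4 * x powr (27 / 28) < 1"
proof -
  have "(1 - x) powr (27 / 28) \<le> 1 - 24 / 25 * x"
  proof -
    have "- x - 2 * x\<^sup>2 \<le> ln (1 - x)"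
      using assms by (intro ln_one_minus_pos_lower_bound) auto
    moreover have "x\<^sup>2 \<le> x * (1 / 50)"
      using assms by (auto simp: power2_eq_square intro!: mult_left_mono)
    ultimately have l: "- (1 / 28) * ln (1 - x) \<le> x / 25" using assms by (simp add: field_simps)
    have "(1 - x) powr (27 / 28) = (1 - x) powr (1 + (- (1 / 28)))" by simp
    also have "\<dots> = (1 - x) * exp (- (1 / 28) * ln (1 - x))"
      using assms by (subst powr_add) (simp add: powr_def)
    also have "\<dots> \<le> (1 - x) * exp (x / 25)"
      using l assms by (intro mult_left_mono) auto
    also have "\<dots> \<le> (1 - x) * (1 + x / 25 + (x / 25)\<^sup>2)"
      using assms by (intro mult_left_mono exp_bound) auto
    also have "\<dots> \<le> 1 - 24 / 25 * x"
      using assms by (simp add: field_simps power2_eq_square)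
    finally show ?thesis .
  qed
  moreover have "x powr (27 / 28) \<le> 6 / 5 * x"
  proof -
    have "x powr (27 / 28) = x powr (1 + (- (1 / 28)))" by simp
    also have "\<dots> = x * (1 / x) powr (1 / 28)"
      using assms by (subst powr_add) (simp add: powr_minus powr_divide field_simps)
    also have "\<dots> \<le> x * (((6 / 5) ^ 28) powr (1 / 28))"
    proof (intro mult_left_mono powr_mono2)
      have "1 / x \<le> 128" using assms by (simp add: field_simps)
      \<comment> \<open>The 28 in the exponent is large enough for \<open>128 powr (1 / 28)\<close>
        to stay below \<open>6 / 5\<close>.\<close>
      also have "(128 :: real) \<le> (6 / 5) ^ 28" by (simp add: field_simps)
      finally show "1 / x \<le> (6 / 5) ^ 28" .
    qed (use assms in auto)
    also have "((6 / 5 :: real) ^ 28) powr (1 / 28) = 6 / 5"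
      using powr_powr[of "6 / 5 :: real" 28 "1 / 28"] by (simp only: powr_numeral) simp
    finally show ?thesis by simp
  qed
  ultimately show ?thesis using assms by linarith
qed

text \<open>Without the hole \<open>X' \<times> Y'\<close>, all edges lie in
  \<open>(A - X') \<times> B\<close> or \<open>X' \<times> (B - Y')\<close>. Averaging passes to
  squares of sides \<open>s - k\<close> and \<open>k\<close>, maximality bounds these, and by
  \<open>powr_hole_ineq\<close> the total is too small.\<close>

lemma maximal_pair_joined:
  fixes c :: real
  assumes fin: "finite A" "finite B" and card: "card A = s" "card B = s"
    and c: "c > 0" and dense: "real (card (E \<inter> A \<times> B)) = c * real s powr (2 - 1 / 28)"
    and max: "\<And>X Y. \<lbrakk>X \<subseteq> A; Y \<subseteq> B; card X = card Y; k \<le> card X\<rbrakk> \<Longrightarrow>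
       real (card (E \<inter> X \<times> Y)) \<le> c * real (card X) powr (2 - 1 / 28)"
    and k: "s \<le> 128 * k" "50 * k \<le> s" "k > 0"
    and XY: "X \<subseteq> A" "Y \<subseteq> B" "k \<le> card X" "s \<le> 4 * card Y"
  shows "\<exists>x\<in>X. \<exists>y\<in>Y. (x, y) \<in> E"
proof (rule ccontr)
  assume hole: "\<not> ?thesis"
  obtain X' where X': "X' \<subseteq> X" "card X' = k"
    using XY(3) by (metis obtain_subset_with_card_n)
  obtain Y' where Y': "Y' \<subseteq> Y" "card Y' = (s + 3) div 4"
    using XY(4) obtain_subset_with_card_n[of "(s + 3) div 4" Y] by force
  have finX: "finite X'" "finite Y'" "X' \<subseteq> A" "Y' \<subseteq> B"
    using X' Y' XY fin by (meson finite_subset order_trans)+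
  have cA: "card (A - X') = s - k" using finX X' card by (simp add: card_Diff_subset)
  have cB: "card (B - Y') = s - (s + 3) div 4" using finX Y' card by (simp add: card_Diff_subset)
  have "E \<inter> A \<times> B = (E \<inter> (A - X') \<times> B) \<union> (E \<inter> X' \<times> (B - Y'))"
    using hole X' Y' finX XY by blast
  then have "card (E \<inter> A \<times> B) \<le> card (E \<inter> (A - X') \<times> B) + card (E \<inter> X' \<times> (B - Y'))"
    by (metis card_Un_le)
  then have sum: "c * real s powr (2 - 1 / 28) \<le>
      real (card (E \<inter> (A - X') \<times> B)) + real (card (E \<inter> X' \<times> (B - Y')))"
    using dense by linarith
  have split: "real m powr (2 - 1 / 28) = real m * real m powr (27 / 28)" if "m > 0" for m
    using that powr_add[of "real m" 1 "27 / 28"] by simp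
  have s: "s > 0" "k < s" using k by auto
  obtain B1 where B1: "B1 \<subseteq> B" "card B1 = s - k"
    "(s - k) * card (E \<inter> (A - X') \<times> B) \<le> card B * card (E \<inter> (A - X') \<times> B1)"
    by (rule dense_subset[of "A - X'" B "s - k" E]) (use fin card in auto)
  have "real (s - k) * real (card (E \<inter> (A - X') \<times> B)) \<le> real s * real (card (E \<inter> (A - X') \<times> B1))"
    using B1(3) card by (metis of_nat_le_iff of_nat_mult)
  also have "\<dots> \<le> real s * (c * real (s - k) powr (2 - 1 / 28))"
    using max[of "A - X'" B1] B1 cA k by (intro mult_left_mono) auto
  also have "\<dots> = real (s - k) * (real s * c * real (s - k) powr (27 / 28))"
    using split[of "s - k"] s by simp
  finally have e1: "real (card (E \<inter> (A - X') \<times> B)) \<le> real s * c * real (s - k) powr (27 / 28)"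
    using s by (subst (asm) mult_le_cancel_left_pos) auto
  obtain B2 where B2: "B2 \<subseteq> B - Y'" "card B2 = k"
    "k * card (E \<inter> X' \<times> (B - Y')) \<le> card (B - Y') * card (E \<inter> X' \<times> B2)"
    by (rule dense_subset[of X' "B - Y'" k E]) (use fin finX cB k in auto)
  have "real k * real (card (E \<inter> X' \<times> (B - Y'))) \<le> real (card (B - Y')) * real (card (E \<inter> X' \<times> B2))"
    using B2(3) by (metis of_nat_le_iff of_nat_mult)
  also have "\<dots> \<le> (3 / 4 * real s) * (c * real k powr (2 - 1 / 28))"
  proof (rule mult_mono)
    have "4 * card (B - Y') \<le> 3 * s" using cB by linarith
    then show "real (card (B - Y')) \<le> 3 / 4 * real s" by linarith
    show "real (card (E \<inter> X' \<times> B2)) \<le> c * real k powr (2 - 1 / 28)"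
      using max[of X' B2] B2 X' finX by auto
  qed auto
  also have "\<dots> = real k * (real s * c * (3 / 4 * real k powr (27 / 28)))"
    using split[of k] k by simp
  finally have e2: "real (card (E \<inter> X' \<times> (B - Y'))) \<le> real s * c * (3 / 4 * real k powr (27 / 28))"
    using k by (subst (asm) mult_le_cancel_left_pos) auto
  have "real s * c * real s powr (27 / 28) \<le>
      real s * c * (real (s - k) powr (27 / 28) + 3 / 4 * real k powr (27 / 28))"
    using sum e1 e2 split[of s] s by (simp add: algebra_simps)
  then have le: "real s powr (27 / 28) \<le> real (s - k) powr (27 / 28) + 3 / 4 * real k powr (27 / 28)"
    using s c by (subst (asm) mult_le_cancel_left_pos) auto
  define x where "x = real k / real s"
  have x: "1 / 128 \<le> x" "x \<le> 1 / 50"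
    using k s by (auto simp: x_def field_simps)
  have eqs: "real (s - k) = real s * (1 - x)" "real k = real s * x"
    using s by (auto simp: x_def field_simps of_nat_diff)
  have "real (s - k) powr (27 / 28) + 3 / 4 * real k powr (27 / 28) =
      real s powr (27 / 28) * ((1 - x) powr (27 / 28) + 3 / 4 * x powr (27 / 28))"
    unfolding eqs using x by (simp add: powr_mult distrib_left)
  also have "\<dots> < real s powr (27 / 28) * 1"
    using powr_hole_ineq[OF x] s by (intro mult_strict_left_mono) auto
  finally show False using le by simp
qed

text \<open>The exponent \<open>2 - 1 / 28\<close> below rewards density over size: a maximiser of
  \<open>e(A, B) / \<bar>A\<bar> powr (2 - 1 / 28)\<close> cannot be too small, and a large hole in it would
  leave one of the remaining blocks with a larger ratio.\<close>

lemma joined_pair_exists: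
  fixes D q :: real
  assumes fin: "finite V1" "finite V2" and card: "card V1 = N" "card V2 = N"
    and t: "t > 0" "128 * q powr 28 * real t \<le> real N" and q: "q \<ge> 1" and D: "D > 0"
    and upper: "\<And>X Y. \<lbrakk>X \<subseteq> V1; Y \<subseteq> V2; card X = card Y; t \<le> card X\<rbrakk> \<Longrightarrow>
       real (card (E \<inter> X \<times> Y)) \<le> D * real (card X) ^ 2"
    and lower: "D * real N ^ 2 \<le> q * real (card (E \<inter> V1 \<times> V2))"
  obtains A B s where "A \<subseteq> V1" "B \<subseteq> V2" "card A = s" "card B = s" "128 * t \<le> s"
    "\<And>k X Y. \<lbrakk>s \<le> 128 * k; 50 * k \<le> s; X \<subseteq> A; Y \<subseteq> B; k \<le> card X; s \<le> 4 * card Y\<rbrakk>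
       \<Longrightarrow> \<exists>x\<in>X. \<exists>y\<in>Y. (x, y) \<in> E"
    "\<And>k X Y. \<lbrakk>s \<le> 128 * k; 50 * k \<le> s; X \<subseteq> A; Y \<subseteq> B; k \<le> card Y; s \<le> 4 * card X\<rbrakk>
       \<Longrightarrow> \<exists>x\<in>X. \<exists>y\<in>Y. (x, y) \<in> E"
proof -
  define P where "P = {(X, Y). X \<subseteq> V1 \<and> Y \<subseteq> V2 \<and> card X = card Y \<and> t \<le> card X}"
  define g where "g = (\<lambda>(X, Y). real (card (E \<inter> X \<times> Y)) / real (card X) powr (2 - 1 / 28))"
  have "128 * 1 * real t \<le> 128 * q powr 28 * real t"
    using q by (intro mult_right_mono mult_left_mono ge_one_powr_ge_zero) auto
  then have tN: "128 * real t \<le> real N" using t(2) by linarith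
  then have N: "N > 0" "t \<le> N" using t by linarith+
  have "finite P"
    by (rule finite_subset[of _ "Pow V1 \<times> Pow V2"]) (use fin in \<open>auto simp: P_def\<close>)
  moreover have VP: "(V1, V2) \<in> P" using N card by (simp add: P_def)
  ultimately obtain p where p: "p \<in> P" "g p = Max (g ` P)"
    by (metis (no_types, lifting) Max_in empty_iff finite_imageI imageE image_is_empty)
  obtain A B where "p = (A, B)" by (cases p)
  then have AB: "(A, B) \<in> P" and maxg: "\<And>p'. p' \<in> P \<Longrightarrow> g p' \<le> g (A, B)"
    using p \<open>finite P\<close> by auto
  define s where "s = card A"
  define c where "c = g (A, B)"
  have A: "A \<subseteq> V1" "B \<subseteq> V2" "card A = s" "card B = s" "t \<le> s"
    using AB by (auto simp: P_def s_def)
  have s: "s > 0" using A(5) t(1) by simp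
  have finAB: "finite A" "finite B" using A fin finite_subset by blast+
  have dense: "real (card (E \<inter> A \<times> B)) = c * real s powr (2 - 1 / 28)"
    using s by (simp add: c_def g_def s_def[symmetric])
  have max: "real (card (E \<inter> X \<times> Y)) \<le> c * real (card X) powr (2 - 1 / 28)"
    if "X \<subseteq> A" "Y \<subseteq> B" "card X = card Y" "t \<le> card X" for X Y
  proof -
    have "(X, Y) \<in> P" using that A by (auto simp: P_def)
    from maxg[OF this] show ?thesis
      using that t by (simp add: c_def[symmetric]) (simp add: g_def divide_le_eq)
  qed
  have split: "real m ^ 2 = real m powr (1 / 28) * real m powr (2 - 1 / 28)" if "m > 0" for m
    using that by (simp add: powr_add[symmetric] powr_numeral)
  \<comment> \<open>\<open>upper\<close> bounds the maximal ratio \<open>c\<close> from above, and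
    comparison with the whole pair bounds it from below. Together they give
    \<open>N \<le> q powr 28 * s\<close>, so passing to the maximiser costs at most a factor
    \<open>q powr 28\<close> in size.\<close>
  have "c * real s powr (2 - 1 / 28) \<le> D * real s ^ 2"
    using upper[OF A(1,2)] A dense by simp
  also have "\<dots> = (D * real s powr (1 / 28)) * real s powr (2 - 1 / 28)"
    using split[OF s] by simp
  finally have c_le: "c \<le> D * real s powr (1 / 28)"
    using s by (subst (asm) mult_le_cancel_right_pos) auto
  have "D * real N powr (1 / 28) * real N powr (2 - 1 / 28) \<le> q * real (card (E \<inter> V1 \<times> V2))"
    using lower split[OF N(1)] by simp
  also have "\<dots> \<le> q * (c * real N powr (2 - 1 / 28))"
  proof (intro mult_left_mono)
    show "real (card (E \<inter> V1 \<times> V2)) \<le> c * real N powr (2 - 1 / 28)"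
      using maxg[OF VP] N card by (simp add: c_def[symmetric]) (simp add: g_def divide_le_eq)
  qed (use q in simp)
  finally have "D * real N powr (1 / 28) \<le> q * c"
    using N by (subst (asm) mult.assoc[symmetric], subst (asm) mult_le_cancel_right_pos) auto
  then have c_ge: "D * real N powr (1 / 28) \<le> D * (q * real s powr (1 / 28))" and cpos: "c > 0"
  proof -
    assume *: "D * real N powr (1 / 28) \<le> q * c"
    also have "\<dots> \<le> q * (D * real s powr (1 / 28))"
      using c_le q by (intro mult_left_mono) auto
    finally show "D * real N powr (1 / 28) \<le> D * (q * real s powr (1 / 28))" by (simp add: mult_ac)
    have "0 < D * real N powr (1 / 28)" using D N by simp
    with * have "0 < q * c" by linarith
    then show "c > 0" using q by (simp add: zero_less_mult_iff)
  qed
  have "real N powr (1 / 28) \<le> q * real s powr (1 / 28)"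
    using c_ge D by (subst (asm) mult_le_cancel_left_pos) auto
  then have "(real N powr (1 / 28)) powr 28 \<le> (q * real s powr (1 / 28)) powr 28"
    by (intro powr_mono2) auto
  then have "real N \<le> q powr 28 * real s"
    using q s N by (simp add: powr_mult powr_powr)
  then have "q powr 28 * (128 * real t) \<le> q powr 28 * real s"
    using t by (simp add: mult_ac)
  then have "128 * real t \<le> real s"
    using q by (subst (asm) mult_le_cancel_left_pos) auto
  \<comment> \<open>Now every \<open>k\<close> with \<open>s \<le> 128 * k\<close> is at least
    \<open>t\<close>, so maximality covers all sets of size \<open>k\<close>.\<close>
  then have ts: "128 * t \<le> s" by linarith
  show ?thesis
  proof (rule that[OF A(1-4) ts])
    fix k X Y
    assume *: "s \<le> 128 * k" "50 * k \<le> s" "X \<subseteq> A" "Y \<subseteq> B" "k \<le> card X" "s \<le> 4 * card Y"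
    then have "k > 0" "t \<le> k" using s ts by linarith+
    then show "\<exists>x\<in>X. \<exists>y\<in>Y. (x, y) \<in> E"
      using * max by (intro maximal_pair_joined[OF finAB A(3,4) cpos dense, of k X Y]) auto
  next
    fix k X Y
    assume *: "s \<le> 128 * k" "50 * k \<le> s" "X \<subseteq> A" "Y \<subseteq> B" "k \<le> card Y" "s \<le> 4 * card X"
    have flip: "card (E\<inverse> \<inter> Y' \<times> X') = card (E \<inter> X' \<times> Y')" for X' Y'
      by (subst card_inverse[symmetric]) (simp add: converse_Int converse_Times)
    have k: "k > 0" "t \<le> k" using s ts * by linarith+
    have "\<exists>y\<in>Y. \<exists>x\<in>X. (y, x) \<in> E\<inverse>"
    proof (rule maximal_pair_joined[OF finAB(2,1) A(4,3) cpos])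
      show "real (card (E\<inverse> \<inter> B \<times> A)) = c * real s powr (2 - 1 / 28)"
        using dense by (simp add: flip)
      show "real (card (E\<inverse> \<inter> Y' \<times> X')) \<le> c * real (card Y') powr (2 - 1 / 28)"
        if "Y' \<subseteq> B" "X' \<subseteq> A" "card Y' = card X'" "k \<le> card Y'" for Y' X'
        using max[of X' Y'] that k by (simp add: flip)
    qed (use * k in auto)
    then show "\<exists>x\<in>X. \<exists>y\<in>Y. (x, y) \<in> E" by blast
  qed
qed

section \<open>The random host graph\<close>

text \<open>The index \<open>(a, i)\<close> stands for the \<open>i\<close>-th random neighbour of
  the left vertex \<open>a\<close>; its block depends on \<open>i\<close> alone, and the offset
  \<open>N\<close> separates right from left. A function in \<open>PiE\<close> over these blocks is
  one outcome, and counting functions replaces probability.\<close>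

definition block :: "nat \<Rightarrow> nat \<Rightarrow> nat \<times> nat \<Rightarrow> nat set" where
  "block N M x = {N + snd x * M..<N + Suc (snd x) * M}"

lemma block_disjoint:
  assumes "y \<in> block N M x" "y \<in> block N M x'"
  shows "snd x = snd x'"
proof -
  have "(y - N) div M = snd z" if "y \<in> block N M z" for z
  proof (rule div_nat_eqI)
    show "M * snd z \<le> y - N" "y - N < M * Suc (snd z)"
      using that by (auto simp: block_def mult.commute)
  qed
  then show ?thesis using assms by metis
qed

lemma card_block: "card (block N M x) = M"
  by (simp add: block_def)

text \<open>An unnormalised expectation of \<open>2 ^ e(A, B)\<close>. Independent choices make the
  sum a product, each factor \<open>M + d\<close> is at most \<open>M * exp (d / M)\<close>, and
  since blocks are disjoint the \<open>d\<close> for one left vertex add up to at most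
  \<open>card B\<close>.\<close>

lemma exp_moment_bound:
  assumes M: "M > 0" and A: "A \<subseteq> {..<N}" and B: "finite B"
  shows "(\<Sum>f\<in>PiE ({..<N} \<times> {..<c}) (block N M). 2 ^ card {x \<in> A \<times> {..<c}. f x \<in> B}) \<le>
    real M ^ (N * c) * exp (real (card A * card B) / real M)"
proof -
  define I where "I = {..<N} \<times> {..<c}"
  define w :: "nat \<times> nat \<Rightarrow> nat \<Rightarrow> real" where "w x y = (if fst x \<in> A \<and> y \<in> B then 2 else 1)" for x y
  define d where "d x = (if fst x \<in> A then card (B \<inter> block N M x) else 0)" for x
  have finI: "finite I" "finite A" "card I = N * c"
    using A finite_subset by (auto simp: I_def)
  have AI: "A \<times> {..<c} \<subseteq> I" using A by (auto simp: I_def)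
  have w: "2 ^ card {x \<in> A \<times> {..<c}. f x \<in> B} = (\<Prod>x\<in>I. w x (f x))" for f
  proof -
    have "(\<Prod>x\<in>I. w x (f x)) = (\<Prod>x\<in>{x \<in> A \<times> {..<c}. f x \<in> B}. 2)"
      using finI AI by (intro prod.mono_neutral_cong_right) (auto simp: w_def I_def)
    then show ?thesis by simp
  qed
  have "(\<Sum>f\<in>PiE I (block N M). 2 ^ card {x \<in> A \<times> {..<c}. f x \<in> B}) =
      (\<Prod>x\<in>I. \<Sum>y\<in>block N M x. w x y)"
    unfolding w using finI by (intro prod_sum_PiE[symmetric]) (auto simp: block_def)
  also have "\<dots> \<le> (\<Prod>x\<in>I. real M * exp (real (d x) / real M))"
  proof (intro prod_mono conjI)
    fix x assume "x \<in> I"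
    show "0 \<le> (\<Sum>y\<in>block N M x. w x y)" by (intro sum_nonneg) (simp add: w_def)
    have "(\<Sum>y\<in>block N M x. w x y) = (\<Sum>y\<in>block N M x. 1 + (if fst x \<in> A \<and> y \<in> B then 1 else 0))"
      by (intro sum.cong) (auto simp: w_def)
    also have "\<dots> = real M + real (d x)"
      by (auto simp: sum.distrib card_block d_def block_def Int_commute sum.If_cases Int_def
            intro!: arg_cong[where f = card])
    also have "\<dots> = real M * (1 + real (d x) / real M)"
      using M by (simp add: field_simps)
    also have "\<dots> \<le> real M * exp (real (d x) / real M)"
      by (intro mult_left_mono exp_ge_add_one_self) auto
    finally show "(\<Sum>y\<in>block N M x. w x y) \<le> real M * exp (real (d x) / real M)" .
  qed
  also have "\<dots> = real M ^ (N * c) * exp (real (\<Sum>x\<in>I. d x) / real M)"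
    using finI by (simp add: prod.distrib exp_sum[symmetric] sum_divide_distrib)
  also have "\<dots> \<le> real M ^ (N * c) * exp (real (card A * card B) / real M)"
  proof -
    have "(\<Sum>x\<in>I. d x) = (\<Sum>x\<in>A \<times> {..<c}. card (B \<inter> block N M x))"
      using finI AI by (intro sum.mono_neutral_cong_right) (auto simp: d_def I_def)
    also have "\<dots> = (\<Sum>a\<in>A. \<Sum>i<c. card (B \<inter> block N M (a, i)))"
      by (simp add: sum.cartesian_product)
    also have "\<dots> \<le> (\<Sum>a\<in>A. card B)"
    proof (rule sum_mono)
      fix a
      have "(\<Sum>i<c. card (B \<inter> block N M (a, i))) = card (\<Union>i<c. B \<inter> block N M (a, i))"
        using B by (intro card_UN_disjoint[symmetric]) (auto dest: block_disjoint)
      also have "\<dots> \<le> card B" using B by (intro card_mono) auto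
      finally show "(\<Sum>i<c. card (B \<inter> block N M (a, i))) \<le> card B" .
    qed
    finally have "(\<Sum>x\<in>I. d x) \<le> card A * card B" by simp
    then have "real (\<Sum>x\<in>I. d x) \<le> real (card A * card B)" by (simp only: of_nat_le_iff)
    then show ?thesis
      by (intro mult_left_mono) (auto intro!: divide_right_mono)
  qed
  finally show ?thesis by (simp add: I_def)
qed

text \<open>Markov's inequality for the exponential moment: with
  \<open>y = card A * card B / M\<close>, a bad function contributes at least
  \<open>2 powr (4 * y)\<close>, so the bad fraction is at most \<open>(exp 1 / 16) powr y\<close>,
  where \<open>y \<ge> N\<close>.\<close>

lemma card_dense_functions:
  assumes M: "M > 0" and A: "A \<subseteq> {..<N}" and B: "finite B" and large: "N * M \<le> card A * card B"
  shows "real (card {f \<in> PiE ({..<N} \<times> {..<c}) (block N M).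
      4 * card A * card B < M * card {x \<in> A \<times> {..<c}. f x \<in> B}}) \<le> real M ^ (N * c) * (3 / 16) ^ N"
    (is "real (card ?F) \<le> _")
proof -
  define y where "y = real (card A * card B) / real M"
  have "real N * real M \<le> real (card A * card B)" using large by (metis of_nat_le_iff of_nat_mult)
  then have y: "real N \<le> y" using M by (simp add: y_def field_simps)
  have finP: "finite (PiE ({..<N} \<times> {..<c}) (block N M))"
    by (intro finite_PiE) (auto simp: block_def)
  have "real (card ?F) * 2 powr (4 * y) = (\<Sum>f\<in>?F. 2 powr (4 * y))" by simp
  also have "\<dots> \<le> (\<Sum>f\<in>?F. 2 ^ card {x \<in> A \<times> {..<c}. f x \<in> B})"
  proof (rule sum_mono)
    fix f assume "f \<in> ?F"
    then have "real (4 * card A * card B) \<le> real (M * card {x \<in> A \<times> {..<c}. f x \<in> B})"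
      by (simp only: of_nat_le_iff) simp
    then have "4 * y \<le> real (card {x \<in> A \<times> {..<c}. f x \<in> B})"
      using M by (simp add: y_def field_simps)
    then have "2 powr (4 * y) \<le> 2 powr real (card {x \<in> A \<times> {..<c}. f x \<in> B})"
      by (intro powr_mono) auto
    then show "2 powr (4 * y) \<le> 2 ^ card {x \<in> A \<times> {..<c}. f x \<in> B}"
      by (simp add: powr_realpow)
  qed
  also have "\<dots> \<le> (\<Sum>f\<in>PiE ({..<N} \<times> {..<c}) (block N M). 2 ^ card {x \<in> A \<times> {..<c}. f x \<in> B})"
    using finP by (intro sum_mono2) auto
  also have "\<dots> \<le> real M ^ (N * c) * exp y"
    unfolding y_def by (rule exp_moment_bound[OF M A B])
  finally have "real (card ?F) \<le> real M ^ (N * c) * (exp y / 2 powr (4 * y))"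
    by (simp add: pos_le_divide_eq)
  also have "exp y / 2 powr (4 * y) = (exp 1 / 16) powr y"
  proof -
    have "(16 :: real) = 2 powr 4" by simp
    then have "2 powr (4 * y) = 16 powr y" by (simp only: powr_powr)
    moreover have "exp y = exp 1 powr y" by (simp add: powr_def)
    ultimately show ?thesis by (simp add: powr_divide)
  qed
  also have "(exp 1 / 16) powr y \<le> (3 / 16) powr y"
    using y exp_le by (intro powr_mono2) auto
  also have "\<dots> \<le> (3 / 16) powr real N"
    using y by (intro powr_mono') auto
  also have "\<dots> = (3 / 16) ^ N" by (simp add: powr_realpow)
  finally show ?thesis by (simp add: mult_left_mono)
qed

text \<open>Union bound: there are at most \<open>4 ^ N\<close> pairs, each spoiling a fraction of
  at most \<open>(3 / 16) ^ N\<close>, and \<open>(3 / 4) ^ N < 1\<close>.\<close>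

lemma sparse_uniform_function:
  assumes M: "M > 0" and N: "N > 0"
  obtains f where "f \<in> PiE ({..<N} \<times> {..<c}) (block N M)"
    "\<And>A B. \<lbrakk>A \<subseteq> {..<N}; B \<subseteq> {N..<2 * N}; N * M \<le> card A * card B\<rbrakk> \<Longrightarrow>
       M * card {x \<in> A \<times> {..<c}. f x \<in> B} \<le> 4 * card A * card B"
proof -
  define F where "F = PiE ({..<N} \<times> {..<c}) (block N M)"
  define P where "P = {(A, B). A \<subseteq> {..<N} \<and> B \<subseteq> {N..<2 * N} \<and> N * M \<le> card A * card B}"
  define bad where "bad = (\<lambda>(A, B). {f \<in> F. 4 * card A * card B < M * card {x \<in> A \<times> {..<c}. f x \<in> B}})"
  have finF: "finite F" unfolding F_def by (intro finite_PiE) (auto simp: block_def)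
  have cardF: "card F = M ^ (N * c)"
    unfolding F_def by (subst card_PiE) (auto simp: card_block)
  have PP: "P \<subseteq> Pow {..<N} \<times> Pow {N..<2 * N}" by (auto simp: P_def)
  then have finP: "finite P" by (rule finite_subset) auto
  have "card P \<le> card (Pow {..<N} \<times> Pow {N..<2 * N})" using PP by (intro card_mono) auto
  also have "\<dots> = 4 ^ N" by (simp add: card_cartesian_product card_Pow power_mult_distrib[symmetric])
  finally have cardP: "card P \<le> 4 ^ N" .
  have "real (card (\<Union>p\<in>P. bad p)) \<le> real (\<Sum>p\<in>P. card (bad p))"
    using card_UN_le[OF finP] by (simp only: of_nat_le_iff)
  also have "\<dots> = (\<Sum>p\<in>P. real (card (bad p)))" by simp
  also have "\<dots> \<le> (\<Sum>p\<in>P. real M ^ (N * c) * (3 / 16) ^ N)"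
  proof (rule sum_mono)
    fix p assume "p \<in> P"
    then obtain A B where p: "p = (A, B)" "A \<subseteq> {..<N}" "B \<subseteq> {N..<2 * N}" "N * M \<le> card A * card B"
      by (auto simp: P_def)
    then show "real (card (bad p)) \<le> real M ^ (N * c) * (3 / 16) ^ N"
      using card_dense_functions[OF M p(2) _ p(4), of c] finite_subset[OF p(3)]
      by (simp add: bad_def F_def)
  qed
  also have "\<dots> = real (card P) * (real M ^ (N * c) * (3 / 16) ^ N)" by simp
  also have "\<dots> \<le> 4 ^ N * (real M ^ (N * c) * (3 / 16) ^ N)"
  proof (rule mult_right_mono)
    show "real (card P) \<le> 4 ^ N" using cardP by (metis of_nat_le_iff of_nat_numeral of_nat_power)
  qed simp
  also have "\<dots> = real M ^ (N * c) * (3 / 4) ^ N"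
    by (simp add: power_mult_distrib[symmetric] mult.left_commute)
  also have "\<dots> < real M ^ (N * c) * 1"
    using M N by (intro mult_strict_left_mono power_Suc_less_one) (auto simp: power_less_one_iff)
  finally have "card (\<Union>p\<in>P. bad p) < card F"
    using cardF by simp
  then have "\<not> F \<subseteq> (\<Union>p\<in>P. bad p)"
    using card_mono[of "\<Union>p\<in>P. bad p" F] finP finF by (fastforce simp: bad_def)
  then obtain f where f: "f \<in> F" "\<And>p. p \<in> P \<Longrightarrow> f \<notin> bad p" by blast
  show ?thesis
  proof (rule that)
    show "f \<in> PiE ({..<N} \<times> {..<c}) (block N M)" using f(1) by (simp add: F_def)
    fix A B assume "A \<subseteq> {..<N}" "B \<subseteq> {N..<2 * N}" "N * M \<le> card A * card B"
    then have "f \<notin> bad (A, B)" by (intro f(2)) (simp add: P_def)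
    then show "M * card {x \<in> A \<times> {..<c}. f x \<in> B} \<le> 4 * card A * card B"
      using f(1) by (simp add: bad_def)
  qed
qed

section \<open>The arrowing property\<close>

lemma linear_less_two_power:
  fixes K h :: nat
  assumes "10 * K \<le> h"
  shows "K * (2 * h + 3) < 2 ^ h"
proof -
  \<comment> \<open>Of two factors \<open>2 ^ j\<close> of \<open>2 ^ h\<close>, one absorbs
    \<open>5 * K\<close> and the other \<open>Suc j\<close>.\<close>
  define j where "j = h div 2"
  have j: "h \<le> 2 * j + 1" "2 * j \<le> h" unfolding j_def by presburger+
  have "K * (2 * h + 3) \<le> K * (5 * Suc j)"
    using j(1) by (intro mult_le_mono2) simp
  also have "\<dots> = (5 * K) * Suc j" by (simp only: mult_ac)
  also have "\<dots> < 2 ^ j * 2 ^ j"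
  proof (rule mult_less_le_imp_less)
    have "5 * K \<le> j" using j(1) assms by presburger
    then show "5 * K < 2 ^ j" using less_exp[of j] by linarith
    show "Suc j \<le> 2 ^ j" using less_exp[of j] by linarith
  qed auto
  also have "\<dots> = 2 ^ (2 * j)" by (simp add: power_add[symmetric] mult_2)
  also have "\<dots> \<le> (2 :: nat) ^ h" by (intro power_increasing) (use j(2) in auto)
  finally show ?thesis .
qed

lemma power_two_between:
  fixes k :: nat
  assumes "k > 0"
  obtains h where "k \<le> 2 ^ h" "2 ^ h \<le> 2 * k"
proof -
  define h where "h = (LEAST h. k \<le> 2 ^ h)"
  have h: "k \<le> 2 ^ h"
    unfolding h_def by (rule LeastI[of _ k]) (use less_exp[of k] in simp)
  have "2 ^ h \<le> 2 * k"
  proof (cases h)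
    case 0
    then show ?thesis using assms by simp
  next
    case (Suc j)
    then have "\<not> k \<le> 2 ^ j" using not_less_Least[of j "\<lambda>h. k \<le> 2 ^ h"] by (simp add: h_def)
    then show ?thesis using Suc by simp
  qed
  with h show ?thesis by (rule that)
qed

lemma contains_cycle_if_joined:
  fixes A B :: "'a set" and s n :: nat
  assumes J: "fin_graph J" and fin: "finite A" "finite B" and disj: "A \<inter> B = {}"
    and card: "card A = s" "card B = s"
    and joined: "\<And>k X Y. \<lbrakk>s \<le> 128 * k; 50 * k \<le> s; X \<subseteq> A; Y \<subseteq> B; k \<le> card X; s \<le> 4 * card Y\<rbrakk>
       \<Longrightarrow> \<exists>x\<in>X. \<exists>y\<in>Y. {x, y} \<in> edges J"
      "\<And>k X Y. \<lbrakk>s \<le> 128 * k; 50 * k \<le> s; X \<subseteq> A; Y \<subseteq> B; k \<le> card Y; s \<le> 4 * card X\<rbrakk>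
       \<Longrightarrow> \<exists>x\<in>X. \<exists>y\<in>Y. {x, y} \<in> edges J"
    and s: "500 \<le> s" "100 * n \<le> s" "s \<le> K * n" and n: "even n" "20 * K + 3 \<le> n"
  shows "contains_copy J (cycle_graph n)"
proof -
  \<comment> \<open>The ceiling of \<open>s / 128\<close>; \<open>500 \<le> s\<close> absorbs the
    rounding in \<open>100 * k \<le> s\<close>.\<close>
  define k where "k = (s + 127) div 128"
  have k: "s \<le> 128 * k" "100 * k \<le> s" "k > 0" using s(1) by (auto simp: k_def)
  define adj where "adj x y \<longleftrightarrow> {x, y} \<in> edges J \<and> (x \<in> A \<and> y \<in> B \<or> x \<in> B \<and> y \<in> A)" for x y
  interpret joined_bipartite A B adj s k
  proof
    show "\<exists>x\<in>X. \<exists>y\<in>Y. adj x y" if XY: "X \<subseteq> A" "Y \<subseteq> B" "k \<le> card X" "s \<le> 4 * card Y" for X Y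
    proof -
      obtain x y where "x \<in> X" "y \<in> Y" "{x, y} \<in> edges J"
        using joined(1)[OF k(1) _ XY] k(2) by auto
      then show ?thesis using XY by (auto simp: adj_def)
    qed
    show "\<exists>x\<in>X. \<exists>y\<in>Y. adj x y" if XY: "X \<subseteq> B" "Y \<subseteq> A" "k \<le> card X" "s \<le> 4 * card Y" for X Y
    proof -
      obtain x y where "x \<in> X" "y \<in> Y" "{y, x} \<in> edges J"
        using joined(2)[OF k(1) _ XY(2,1,3,4)] k(2) by auto
      then have "x \<in> X" "y \<in> Y" "adj x y" using XY by (auto simp: adj_def insert_commute)
      then show ?thesis by blast
    qed
  qed (use fin card disj k in \<open>auto simp: adj_def insert_commute\<close>)
  obtain h where h: "k \<le> 2 ^ h" "2 ^ h \<le> 2 * k"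
    using power_two_between[OF k(3)] by blast
  \<comment> \<open>The depth \<open>h\<close> is logarithmic in \<open>s\<close>, which is linear
    in \<open>n\<close>. Trees too deep would give
    \<open>2 ^ h \<le> s \<le> K * (2 * h + 3)\<close>, false once
    \<open>10 * K \<le> h\<close>.\<close>
  have "2 * h + 4 \<le> n"
  proof (rule ccontr)
    assume "\<not> 2 * h + 4 \<le> n"
    then have n': "n \<le> 2 * h + 3" by simp
    have "2 ^ h \<le> s" using h(2) k(2) by linarith
    also have "s \<le> K * (2 * h + 3)" using s(3) n' by (meson le_trans mult_le_mono2)
    also have "\<dots> < 2 ^ h" by (rule linear_less_two_power) (use n' n(2) in linarith)
    finally show False by simp
  qed
  then obtain cs where cs: "distinct cs" "length cs = n" "successively adj cs" "adj (last cs) (hd cs)"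
    using cycle_exists[OF n(1) s(2) h] by blast
  have n3: "n \<ge> 3" using \<open>2 * h + 4 \<le> n\<close> by simp
  show ?thesis
  proof (rule contains_copy_cycleI[OF cs(1,2) n3 J])
    fix i assume i: "i < n"
    show "{cs ! i, cs ! (Suc i mod n)} \<in> edges J"
    proof (cases "Suc i = n")
      case True
      have "cs \<noteq> []" using cs(2) n3 by auto
      then have "last cs = cs ! i" "hd cs = cs ! 0"
        using True cs(2) by (auto simp: last_conv_nth hd_conv_nth)
      then show ?thesis using cs(4) True by (simp add: adj_def)
    next
      case False
      then show ?thesis using successively_nth[OF cs(3), of i] cs(2) i by (simp add: adj_def)
    qed
  qed
qed

text \<open>The parameters fit through \<open>t = R * n\<close>: \<open>t * t = N * n\<close> is the
  threshold of the density estimate, and \<open>N = R * t\<close> with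
  \<open>R = 128 * (4 * r) ^ 28\<close> is exactly the loss in \<open>joined_pair_exists\<close> for
  \<open>q = 4 * r\<close>.\<close>

lemma sparse_arrowing_graph:
  fixes r n R :: nat
  assumes r: "r \<ge> 2" and R: "R = 128 * (4 * r) ^ 28" and n: "even n" "n \<ge> 20 * R ^ 2 + 3"
  obtains G :: "nat ugraph" where "fin_graph G" "bipartite G" "num_edges G = R ^ 4 * n"
    "arrows G (1 / real r) (cycle_graph n)"
proof -
  define N where "N = R ^ 2 * n"
  define c where "c = R ^ 2"
  have R1: "R \<ge> 128" using r by (simp add: R)
  have n1: "n > 0" and N1: "N > 0" using n R1 by (auto simp: N_def)
  obtain f where f: "f \<in> PiE ({..<N} \<times> {..<c}) (block N n)"
    and unif: "\<And>A B. \<lbrakk>A \<subseteq> {..<N}; B \<subseteq> {N..<2 * N}; N * n \<le> card A * card B\<rbrakk> \<Longrightarrow>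
       n * card {x \<in> A \<times> {..<c}. f x \<in> B} \<le> 4 * card A * card B"
    using sparse_uniform_function[OF n1 N1, of c] by blast
  define I where "I = {..<N} \<times> {..<c}"
  define e where "e x = {fst x, f x}" for x
  define G :: "nat ugraph" where "G = \<lparr>verts = {..<2 * N}, edges = e ` I\<rparr>"
  have fx: "f x \<in> block N n x" "fst x < N" "N \<le> f x" "f x < 2 * N" if "x \<in> I" for x
  proof -
    show b: "f x \<in> block N n x" using f that by (auto simp: I_def)
    show "fst x < N" using that by (auto simp: I_def)
    have "Suc (snd x) * n \<le> c * n" using that by (intro mult_le_mono1) (auto simp: I_def)
    then show "N \<le> f x" "f x < 2 * N" using b by (auto simp: block_def N_def c_def)
  qed
  have e_eq: "a = fst x \<and> b = f x" if "x \<in> I" "{a, b} = e x" "a < N" for a b x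
    using that fx[OF that(1)] by (auto simp: e_def doubleton_eq_iff)
  \<comment> \<open>No edge arises twice: its left end gives the vertex and its right end the block.
    So the edge count is exactly \<open>N * c\<close>.\<close>
  have inj: "inj_on e I"
  proof (rule inj_onI)
    fix x y assume xy: "x \<in> I" "y \<in> I" "e x = e y"
    have *: "fst x = fst y \<and> f x = f y"
      by (rule e_eq[OF xy(2)]) (use xy fx(2) in \<open>simp_all add: e_def\<close>)
    moreover have "snd x = snd y"
      using block_disjoint[of "f x" N n x y] fx(1)[OF xy(1)] fx(1)[OF xy(2)] * by simp
    ultimately show "x = y" by (simp add: prod_eq_iff)
  qed
  have edges_G: "num_edges G = N * c"
    by (simp add: G_def num_edges_def card_image[OF inj]) (simp add: I_def)
  have finG: "fin_graph G"
    unfolding fin_graph_def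
  proof (intro conjI ballI)
    fix a assume "a \<in> edges G"
    then obtain x where x: "x \<in> I" "a = e x" by (auto simp: G_def)
    then show "a \<subseteq> verts G" "card a = 2" using fx[OF x(1)] by (auto simp: G_def e_def)
  qed (simp add: G_def)
  have "bipartite G"
    unfolding bipartite_def
  proof (rule exI[of _ "{..<N}"], rule exI[of _ "{N..<2 * N}"], intro conjI ballI)
    fix a assume "a \<in> edges G"
    then obtain x where x: "x \<in> I" "a = e x" by (auto simp: G_def)
    then show "\<exists>u\<in>{..<N}. \<exists>v\<in>{N..<2 * N}. a = {u, v}" using fx[OF x(1)]
      by (intro bexI[of _ "fst x"] bexI[of _ "f x"]) (auto simp: e_def)
  qed (auto simp: G_def)
  moreover have "arrows G (1 / real r) (cycle_graph n)"
    unfolding arrows_def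
  proof (intro allI impI, elim conjE)
    fix J :: "nat ugraph"
    assume J: "subgraph J G" "1 / real r * real (num_edges G) \<le> real (num_edges J)"
    \<comment> \<open>\<open>E\<close> is symmetric; intersecting it with left times right orients
      every edge of \<open>J\<close>.\<close>
    define E where "E = {(a, b). {a, b} \<in> edges J}"
    have finJ: "fin_graph J" and JG: "edges J \<subseteq> e ` I"
      using J by (auto simp: subgraph_def G_def)
    have EJ: "card (edges J) \<le> card (E \<inter> {..<N} \<times> {N..<2 * N})"
    proof -
      have "edges J \<subseteq> (\<lambda>(a, b). {a, b}) ` (E \<inter> {..<N} \<times> {N..<2 * N})"
      proof
        fix a assume a: "a \<in> edges J"
        then obtain x where x: "x \<in> I" "a = e x" using JG by blast
        then show "a \<in> (\<lambda>(a, b). {a, b}) ` (E \<inter> {..<N} \<times> {N..<2 * N})"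
          using a fx[OF x(1)] by (intro image_eqI[of _ _ "(fst x, f x)"]) (auto simp: E_def e_def)
      qed
      then show ?thesis by (intro surj_card_le) auto
    qed
    define t where "t = R * n"
    have upper: "real (card (E \<inter> X \<times> Y)) \<le> 4 / real n * real (card X) ^ 2"
      if XY: "X \<subseteq> {..<N}" "Y \<subseteq> {N..<2 * N}" "card X = card Y" "t \<le> card X" for X Y
    proof -
      have fin: "finite X" using XY(1) finite_subset by blast
      have "E \<inter> X \<times> Y \<subseteq> (\<lambda>x. (fst x, f x)) ` {x \<in> X \<times> {..<c}. f x \<in> Y}"
      proof
        fix p assume p: "p \<in> E \<inter> X \<times> Y"
        then obtain a b where ab: "p = (a, b)" "a \<in> X" "b \<in> Y" "{a, b} \<in> edges J"
          by (auto simp: E_def)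
        then obtain x where x: "x \<in> I" "{a, b} = e x" using JG by blast
        have "a < N" using ab XY by auto
        from e_eq[OF x this] show "p \<in> (\<lambda>x. (fst x, f x)) ` {x \<in> X \<times> {..<c}. f x \<in> Y}"
          using ab x(1) by (intro image_eqI[of _ _ x]) (auto simp: I_def)
      qed
      then have "card (E \<inter> X \<times> Y) \<le> card {x \<in> X \<times> {..<c}. f x \<in> Y}"
        using fin by (intro surj_card_le) auto
      then have "n * card (E \<inter> X \<times> Y) \<le> n * card {x \<in> X \<times> {..<c}. f x \<in> Y}" by simp
      also have "\<dots> \<le> 4 * card X * card Y"
      proof (rule unif[OF XY(1,2)])
        have "N * n = t * t" by (simp add: N_def t_def power2_eq_square)
        also have "\<dots> \<le> card X * card Y" using XY(3,4) by (intro mult_le_mono) auto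
        finally show "N * n \<le> card X * card Y" .
      qed
      finally have "real (n * card (E \<inter> X \<times> Y)) \<le> real (4 * card X * card Y)"
        by (simp only: of_nat_le_iff)
      then show ?thesis
        using XY(3) n1 by (simp add: field_simps power2_eq_square)
    qed
    \<comment> \<open>\<open>4 / n * N ^ 2\<close> is four times the number of edges of
      \<open>G\<close>, of which \<open>J\<close> keeps at least a fraction \<open>1 / r\<close>;
      hence \<open>q = 4 * r\<close>.\<close>
    have lower: "4 / real n * real N ^ 2 \<le> real (4 * r) * real (card (E \<inter> {..<N} \<times> {N..<2 * N}))"
    proof -
      have "real N * real c \<le> real r * real (num_edges J)"
        using J(2) r by (simp add: edges_G field_simps)
      also have "\<dots> \<le> real r * real (card (E \<inter> {..<N} \<times> {N..<2 * N}))"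
        using EJ by (intro mult_left_mono) (auto simp: num_edges_def)
      finally have "4 * (real N * real c) \<le> real (4 * r) * real (card (E \<inter> {..<N} \<times> {N..<2 * N}))"
        by simp
      moreover have "real N = real c * real n" by (simp add: N_def c_def)
      then have "4 / real n * real N ^ 2 = 4 * (real N * real c)"
        using n1 by (simp add: power2_eq_square)
      ultimately show ?thesis by simp
    qed
    have "real (4 * r) powr 28 = real ((4 * r) ^ 28)" using r by (simp add: powr_numeral)
    then have "128 * real (4 * r) powr 28 = real R" by (simp add: R)
    then have tN: "128 * real (4 * r) powr 28 * real t \<le> real N"
      by (simp only:) (simp add: t_def N_def power2_eq_square)
    obtain A B s where AB: "A \<subseteq> {..<N}" "B \<subseteq> {N..<2 * N}" "card A = s" "card B = s" "128 * t \<le> s"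
      and join: "\<And>k X Y. \<lbrakk>s \<le> 128 * k; 50 * k \<le> s; X \<subseteq> A; Y \<subseteq> B; k \<le> card X; s \<le> 4 * card Y\<rbrakk>
         \<Longrightarrow> \<exists>x\<in>X. \<exists>y\<in>Y. (x, y) \<in> E"
        "\<And>k X Y. \<lbrakk>s \<le> 128 * k; 50 * k \<le> s; X \<subseteq> A; Y \<subseteq> B; k \<le> card Y; s \<le> 4 * card X\<rbrakk>
         \<Longrightarrow> \<exists>x\<in>X. \<exists>y\<in>Y. (x, y) \<in> E"
    proof (rule joined_pair_exists[of "{..<N}" "{N..<2 * N}" N t "real (4 * r)" "4 / real n" E])
      show "t > 0" using R1 n1 by (simp add: t_def)
    qed (use tN upper lower r n1 in auto)
    have Rn: "128 * n \<le> t" using R1 by (simp add: t_def)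
    show "contains_copy J (cycle_graph n)"
    proof (rule contains_cycle_if_joined[OF finJ _ _ _ AB(3,4), of n "R ^ 2"])
      show "finite A" "finite B" "A \<inter> B = {}" using AB(1,2) finite_subset by fastforce+
      show "500 \<le> s" "100 * n \<le> s" using AB(5) Rn n1 by linarith+
      show "s \<le> R ^ 2 * n" using card_mono[OF _ AB(1)] AB(3) by (simp add: N_def)
    qed (use join n in \<open>auto simp: E_def\<close>)
  qed
  moreover have "num_edges G = R ^ 4 * n"
    by (simp add: edges_G N_def c_def power_mult_distrib flip: power_add)
  ultimately show ?thesis using that finG by blast
qed

theorem theorem3p4:
  "\<exists>C::real. C > 0 \<and>
     (\<forall>r::nat. r \<ge> 2 \<longrightarrow>
       (\<exists>n0::nat. \<forall>n::nat. n \<ge> n0 \<and> even n \<longrightarrow>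
         (\<exists>G :: nat ugraph. fin_graph G \<and> bipartite G \<and>
            real (num_edges G) \<le> C * real r ^ 120 * (ln (real r))\<^sup>2 * real n \<and>
            arrows G (1 / real r) (cycle_graph n))))"
proof -
  \<comment> \<open>\<open>R ^ 4\<close> is \<open>(128 * 4 ^ 28) ^ 4 * r ^ 112\<close>, and
    \<open>r ^ 112 \<le> r ^ 120\<close>. The leading 4 compensates for the logarithm, since
    \<open>ln r \<ge> 1 / 2\<close> for \<open>r \<ge> 2\<close>.\<close>
  define C :: real where "C = 4 * (128 * 4 ^ 28) ^ 4"
  have "\<exists>G :: nat ugraph. fin_graph G \<and> bipartite G \<and>
      real (num_edges G) \<le> C * real r ^ 120 * (ln (real r))\<^sup>2 * real n \<and>
      arrows G (1 / real r) (cycle_graph n)"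
    if r: "r \<ge> 2" and n: "20 * (128 * (4 * r) ^ 28) ^ 2 + 3 \<le> n" "even n" for r n :: nat
  proof -
    define R where "R = 128 * (4 * r) ^ 28"
    obtain G :: "nat ugraph" where G: "fin_graph G" "bipartite G" "num_edges G = R ^ 4 * n"
      "arrows G (1 / real r) (cycle_graph n)"
      using sparse_arrowing_graph[OF r R_def n(2)] n(1) by (auto simp: R_def)
    have "1 / 2 \<le> ln (2 :: real)"
      using ln_add_one_self_le_self2[of "-1 / 2"] by (simp add: ln_div)
    also have "\<dots> \<le> ln (real r)" using r by simp
    finally have "(1 / 2)\<^sup>2 \<le> (ln (real r))\<^sup>2" by (intro power_mono) auto
    then have ln: "1 \<le> 4 * (ln (real r))\<^sup>2" by (simp add: power2_eq_square)
    have "real (R ^ 4) = (128 * 4 ^ 28) ^ 4 * real r ^ 112 * 1"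
      by (simp add: R_def power_mult_distrib flip: power_mult)
    also have "\<dots> \<le> (128 * 4 ^ 28) ^ 4 * real r ^ 120 * (4 * (ln (real r))\<^sup>2)"
      using r ln by (intro mult_mono power_increasing) auto
    also have "\<dots> = C * real r ^ 120 * (ln (real r))\<^sup>2" by (simp only: C_def mult_ac)
    finally have "real (num_edges G) \<le> C * real r ^ 120 * (ln (real r))\<^sup>2 * real n"
      unfolding G(3) of_nat_mult by (rule mult_right_mono) simp
    then show ?thesis using G by blast
  qed
  moreover have "C > 0" by (simp add: C_def)
  ultimately show ?thesis by blast
qed

end
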